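(* Let $a>0$ and for $\Re s>1$ define \[ S(s)=\frac{1}{\Gamma(\frac{s}{2})}\int_0^a \Phi(x)\,x^{\frac{s}{2}}\frac{dx}{x}. \] Then $S(s)$ extends to a meromorphic function on $\mathbf{C}$ with poles at $s=1$ and $s=-(2n-1)$ for $n=1,2,\dots$. Moreover, let $N$ be a natural number and $s=\sigma+it$ with $\sigma>-N-1$. Then, as $a\to0^+$, \[ S(s)=\frac{a^{\frac{s-1}{2}}}{4\sqrt{\pi}\,\Gamma(s/2)}\Bigl\{-\frac{2}{(s-1)^2}+\frac{C_0+\log(16\pi^2 a)}{s-1}+\sum_{n=1}^N \frac{B_n(3/4)}{n!}\frac{(4\sqrt{a})^n\,\Gamma(\frac{n}{2})}{s+n-1}\Bigr\}+O\bigl(a^{\frac{N+\sigma}{2}}\bigr), \] where the implicit constant depends on $s$ and $N$.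
   Context: For $x>0$, $\Phi(x):=\frac{1}{2\pi}\int_0^{+\infty}e^{-xt^2}\Psi(t)\,dt$ with $\Psi(t):=\log 2\pi+\frac{\pi}{2\cosh\pi t}-\Re\{\Gamma'(\frac12+it)/\Gamma(\frac12+it)\}$; equivalently $\Phi(x)=\frac{C_0+\log 16\pi^2x}{8\sqrt{\pi x}}-\frac{1}{4\sqrt{\pi x}}\int_0^{+\infty}e^{-\frac{u^2}{16x}}\bigl(\frac{1}{u}-\frac{e^{\frac34 u}}{e^u-1}\bigr)\,du$. $C_0$ is Euler's constant, and $B_n(y)$ are the Bernoulli polynomials, defined by $\frac{ue^{yu}}{e^u-1}=\sum_{n\ge0}B_n(y)\frac{u^n}{n!}$. *)

theory Defs
  imports
    "HOL-Complex_Analysis.Complex_Analysis"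
    "HOL-Library.Landau_Symbols"
begin

definition Psi :: "real \<Rightarrow> real" where
  "Psi t = ln (2 * pi) + pi / (2 * cosh (pi * t))
           - Re (deriv Gamma (1/2 + \<i> * of_real t) / Gamma (1/2 + \<i> * of_real t))"

definition Phi :: "real \<Rightarrow> real" where
  "Phi x = 1 / (2 * pi) * (LINT t:{0<..}|lborel. exp (- x * t^2) * Psi t)"

text \<open>
  The generating function \<open>u e\<^bsup>yu\<^esup> / (e\<^sup>u - 1)\<close> is taken as a quotient of formal power
  series; the division is exact, see \<open>bernpoly_generating_function\<close>.
\<close>

definition bernpoly :: "nat \<Rightarrow> real \<Rightarrow> real" where
  "bernpoly n y = fact n * fps_nth (fps_X * fps_exp y / (fps_exp 1 - 1)) n"

lemma bernpoly_generating_function: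
  "Abs_fps (\<lambda>n. bernpoly n y / fact n) * (fps_exp 1 - 1) = fps_X * fps_exp y"
proof -
  let ?g = "fps_exp 1 - 1 :: real fps"
  have g1: "fps_nth ?g 1 \<noteq> 0" and g0: "fps_nth ?g 0 = 0" by simp_all
  have "subdegree ?g = 1"
    using g0 g1 by (intro subdegreeI) auto
  moreover have "subdegree (fps_X * fps_exp y) \<ge> 1"
    by (intro subdegree_geI) (auto simp: fps_eq_iff intro!: exI[of _ 1])
  moreover have "?g \<noteq> 0"
    using g1 by auto
  ultimately have "?g dvd fps_X * fps_exp y"
    by (auto simp: fps_dvd_iff)
  moreover have "Abs_fps (\<lambda>n. bernpoly n y / fact n) = fps_X * fps_exp y / ?g"
    by (simp add: fps_eq_iff bernpoly_def)
  ultimately show ?thesis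
    by simp
qed

definition S_int :: "real \<Rightarrow> complex \<Rightarrow> complex" where
  "S_int a s = 1 / Gamma (s / 2) *
     (LINT x:{0<..<a}|lborel. of_real (Phi x) * of_real x powr (s / 2) / of_real x)"

definition S_poles :: "complex set" where
  "S_poles = {1} \<union> {- (2 * of_nat n - 1) |n::nat. n \<ge> 1}"

text \<open>
  At \<open>s = 0, -2, -4, \<dots>\<close> the expansion can have a removable singularity
  \<open>(1 / \<Gamma>(s/2)) * 1 / (s + n - 1)\<close> with \<open>n = 1 - s\<close>, where division by zero gives the wrong
  value. There it has to be read by continuity, i.e. as \<open>remove_sings (S_main N a) s\<close>, which agrees
  with \<open>S_main N a s\<close> at every other \<open>s \<notin> S_poles\<close>.
\<close>

definition S_main :: "nat \<Rightarrow> real \<Rightarrow> complex \<Rightarrow> complex" where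
  "S_main N a s =
     of_real a powr ((s - 1) / 2) / (of_real (4 * sqrt pi) * Gamma (s / 2)) *
     (- 2 / (s - 1)^2
      + of_real (euler_mascheroni + ln (16 * pi^2 * a)) / (s - 1)
      + (\<Sum>n=1..N. of_real (bernpoly n (3/4) / fact n) *
                     (of_real ((4 * sqrt a)^n * Gamma (real n / 2)) / (s + of_nat n - 1))))"

end

theory Submission
  imports Defs "HOL-Probability.Probability" "HOL-Real_Asymp.Real_Asymp"
begin

text \<open>
  The duplication and reflection formulas give
  \<open>\<Psi>(t) = log \<pi> - Re (\<Gamma>'/\<Gamma>)(1/4 + it/2)\<close>. Writing \<open>\<Gamma>'/\<Gamma>\<close> as a limit of sums of
  \<open>1/(1/4 + k + it/2) = \<integral> exp(-(1/4 + k + it/2) u) du\<close> and integrating against the Gaussian yields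
  \<open>\<Phi>(x) = (C\<^sub>0 + log(16 \<pi>\<^sup>2 x) + 2 J(x)) / (8 \<surd>(\<pi>x))\<close> with
  \<open>J(x) = \<integral> exp(-u\<^sup>2/(16x)) g(u) du\<close> and \<open>g(u) = exp(-u/4)/(1 - exp(-u)) - 1/u\<close>.
  The Taylor coefficients of \<open>g\<close> at 0 are \<open>B\<^sub>n(3/4)/n!\<close>, so \<open>\<Phi>\<close> equals an explicit sum plus a remainder
  that is \<open>O(x powr (N/2))\<close> on the whole half-line. The Mellin transform of the remainder over \<open>(0, a)\<close> is
  holomorphic for \<open>Re s > -N\<close>, and the explicit terms integrate to the main term of the expansion.

  A pole at \<open>s = 1 - n\<close> survives multiplication by \<open>1/\<Gamma>(s/2)\<close> exactly if \<open>n\<close> is even, because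
  \<open>B\<^sub>n(3/4) \<noteq> 0\<close> for even \<open>n\<close>. In the strip \<open>-N-1 < Re s \<le> -N\<close> the expansion with \<open>N + 1\<close> terms is used;
  its last term has the size of the error.
\<close>

subsection \<open>Bernoulli polynomials at 3/4\<close>

text \<open>Two obstacles shape the proof. The sums of the exponentials approach a function that
  behaves like 1/u at 0, so their Gaussian integrals grow like log n and cancel the log n of the
  digamma limit only in combination. Comparison with a Frullani integral, a Gaussian against an
  exponential, makes this cancellation exact; it is the source of both C_0 and log x in the formula
  for Phi. The second obstacle is division by zero. At s = 0, -2, -4, ... the explicit terms have
  removable singularities at which x / 0 = 0 yields a false value, so values there are always
  obtained as limits. Two choices keep the analysis short. The remainder of the kernel is bounded by
  a multiple of u^N for every u > 0, so a single Gaussian moment replaces the usual splitting of the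
  integral in Watson's lemma. And passing from N to N + 1 moves one monomial out of the remainder,
  whose truncated Mellin transform is explicit; the candidates for the continuation thus agree
  pointwise and no identity theorem is involved.\<close>

lemma fps_compose_uminus_X_nth: "fps_nth (F oo (- fps_X)) n = (-1) ^ n * fps_nth (F :: real fps) n"
proof -
  have "F oo (- fps_X) = Abs_fps (\<lambda>n. (-1) ^ n * fps_nth F n)"
    using fps_compose_linear[of F "-1"] by (simp flip: fps_const_neg)
  thus ?thesis by simp
qed

definition even_bern :: "real fps" where
  "even_bern = Abs_fps (\<lambda>n. if even n then bernpoly n (3/4) / fact n else 0)"

text \<open>The reflection u -> -u turns u e^(3u/4)/(e^u - 1) into u e^(u/4)/(e^u - 1). In the
  average of the two, the factor e^(u/2) + 1 cancels, which leaves (u/4)/sinh(u/4).\<close>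

lemma even_bern_times_sinh:
  "2 * even_bern * (fps_exp (1/4) - fps_exp (-1/4)) = fps_X"
proof -
  define B where "B = Abs_fps (\<lambda>n. bernpoly n (3/4) / fact n)"
  have B: "B * (fps_exp 1 - 1) = fps_X * fps_exp (3/4)"
    unfolding B_def by (rule bernpoly_generating_function)
  define B' where "B' = B oo (- fps_X)"
  have sum: "B + B' = 2 * even_bern"
    by (simp add: fps_eq_iff B'_def fps_compose_uminus_X_nth even_bern_def B_def)
  have e: "fps_exp c oo (- fps_X) = fps_exp (- c)" for c :: real
    by (simp add: fps_eq_iff fps_compose_uminus_X_nth power_minus[of c] mult_ac)
  have "(B * (fps_exp 1 - 1)) oo (- fps_X) = (fps_X * fps_exp (3/4)) oo (- fps_X)"
    by (simp only: B)
  hence B': "B' * (fps_exp (-1) - 1) = - fps_X * fps_exp (-3/4)"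
    by (simp add: fps_compose_mult_distrib fps_compose_sub_distrib e B'_def)
  have add: "fps_exp a * fps_exp b = fps_exp (a + b)" for a b :: real
    by (simp add: fps_exp_add_mult)
  have "B' * (fps_exp 1 - 1) = - fps_exp 1 * (B' * (fps_exp (-1) - 1))"
    using add[of 1 "-1"] by (simp add: algebra_simps)
  also have "\<dots> = fps_X * (fps_exp 1 * fps_exp (-3/4))"
    by (subst B') (simp add: algebra_simps)
  also have "\<dots> = fps_X * fps_exp (1/4)"
    by (subst add) simp
  finally have B'': "B' * (fps_exp 1 - 1) = fps_X * fps_exp (1/4)" .
  have "2 * even_bern * (fps_exp 1 - 1) = fps_X * (fps_exp (3/4) + fps_exp (1/4))"
    unfolding sum[symmetric] using B B'' by (simp add: algebra_simps)
  also have "fps_exp 1 - 1 = (fps_exp (1/2) + 1) * (fps_exp (1/2) - (1 :: real fps))"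
    using add[of "1/2" "1/2"] by (simp add: algebra_simps)
  also have "fps_exp (3/4) + fps_exp (1/4) = (fps_exp (1/2) + 1) * fps_exp (1/4 :: real)"
    using add[of "1/2" "1/4"] by (simp add: algebra_simps)
  finally have "(fps_exp (1/2) + 1) * (2 * even_bern * (fps_exp (1/2) - 1))
      = (fps_exp (1/2) + 1) * (fps_X * fps_exp (1/4))"
    by (simp add: mult_ac)
  moreover have "(fps_exp (1/2) + 1 :: real fps) \<noteq> 0"
  proof
    assume "(fps_exp (1/2) + 1 :: real fps) = 0"
    hence "fps_nth (fps_exp (1/2) + 1 :: real fps) 0 = 0" by (simp only: fps_zero_nth)
    thus False by simp
  qed
  ultimately have "2 * even_bern * (fps_exp (1/2) - 1) = fps_X * fps_exp (1/4)"
    by (simp only: mult_cancel_left) simp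
  hence "2 * even_bern * (fps_exp (1/2) - 1) * fps_exp (-1/4) = fps_X * (fps_exp (1/4) * fps_exp (-1/4))"
    by (simp add: mult_ac)
  thus ?thesis
    using add[of "1/2" "-1/4"] add[of "1/4" "-1/4"] by (simp add: algebra_simps)
qed

text \<open>
  With \<open>q(u) = (u/4)/sinh(u/4)\<close> and \<open>w(u) = 1 - (u/4) coth(u/4)\<close> we have \<open>u q' = q w\<close> and the Riccati equation
  \<open>u w' = w\<^sup>2 - w - u\<^sup>2/16\<close>. Comparing coefficients, the even coefficients of \<open>w\<close>, and then those of \<open>q\<close>,
  alternate strictly in sign.
\<close>

lemma bernpoly_three_quarters_nonzero:
  assumes "even m"
  shows   "bernpoly m (3/4) \<noteq> 0"
proof -
  define c where "c = fps_const (1/4 :: real)"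
  define S C :: "real fps" where "S = fps_exp (1/4) - fps_exp (-1/4)" and "C = fps_exp (1/4) + fps_exp (-1/4)"
  define Q where "Q = even_bern"
  have QS: "2 * Q * S = fps_X" using even_bern_times_sinh by (simp add: Q_def S_def)
  have S': "fps_deriv S = c * C" and C': "fps_deriv C = c * S"
    by (simp_all add: S_def C_def c_def ring_distribs fps_const_neg[symmetric] del: fps_const_neg)
  have "S \<noteq> 0" using QS by auto
  \<comment> \<open>Since \<open>C\<close> is 2 cosh(u/4) and \<open>c\<close> is 1/4, the product
    \<open>2 * c * Q * C\<close> is (u/4) coth(u/4).\<close>
  define W where "W = 1 - 2 * c * Q * C"
  have QW: "fps_X * fps_deriv Q = Q * W"
  proof -
    have "fps_deriv (2 * Q * S) = 1" by (simp add: QS)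
    hence "fps_X * (2 * fps_deriv Q * S + 2 * Q * (c * C)) = fps_X"
      by (simp add: S' algebra_simps)
    hence "2 * S * (fps_X * fps_deriv Q) = fps_X - fps_X * (2 * Q * (c * C))"
      by (simp add: algebra_simps)
    also have "\<dots> = 2 * Q * S - 2 * Q * S * (2 * Q * (c * C))"
      by (simp only: QS)
    also have "\<dots> = 2 * S * (Q * W)"
      unfolding W_def by (simp add: algebra_simps)
    finally show ?thesis using \<open>S \<noteq> 0\<close> by simp
  qed
  have W: "fps_X * fps_deriv W = W * W - W - c * c * fps_X ^ 2"
  proof -
    have "fps_X * fps_deriv W = - 2 * c * ((fps_X * fps_deriv Q) * C + fps_X * Q * (c * S))"
      by (simp add: W_def C' c_def algebra_simps)
    also have "\<dots> = - 2 * c * Q * W * C - c * c * fps_X * (2 * Q * S)"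
      unfolding QW by (simp add: algebra_simps)
    also have "\<dots> = (W - 1) * W - c * c * fps_X * fps_X"
      unfolding QS by (simp add: W_def algebra_simps)
    finally show ?thesis by (simp add: algebra_simps power2_eq_square)
  qed
  have Q0: "fps_nth Q 0 = 1"
  proof -
    have "fps_nth (2 * Q * S) 1 = 1" by (simp add: QS)
    thus ?thesis by (simp add: fps_mult_nth S_def)
  qed
  have W0: "fps_nth W 0 = 0"
    by (simp add: W_def Q0 c_def C_def)
  \<comment> \<open>Moving the linear term -w to the left turns the factor n into n + 1. As w has
    constant term 0, the end terms of the convolution vanish and this is a genuine recursion; the
    only source term is -1/16 at n = 2.\<close>
  have Wrec: "real (n + 1) * fps_nth W n = (\<Sum>i=0..n. fps_nth W i * fps_nth W (n - i)) - (if n = 2 then 1/16 else 0)" for n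
  proof -
    have "fps_nth (fps_X * fps_deriv W) n = real n * fps_nth W n"
      by (cases n) (auto simp: W0)
    moreover have "fps_nth (c * c * fps_X ^ 2) n = (if n = 2 then 1/16 else 0)"
      by (simp add: c_def fps_X_power_iff mult.assoc)
    ultimately show ?thesis
      using arg_cong[OF W, of "\<lambda>F. fps_nth F n"] by (simp add: fps_mult_nth algebra_simps)
  qed
  \<comment> \<open>For even i and n - i the exponents i/2 and (n - i)/2 add up to n/2, so all
    nonzero products in the convolution carry the same sign and nothing can cancel. The sign is
    seeded by 3 w_2 = -1/16.\<close>
  have Wsign: "(odd n \<longrightarrow> fps_nth W n = 0) \<and> (even n \<and> n > 0 \<longrightarrow> (-1) ^ (n div 2) * fps_nth W n > 0)" for n
  proof (induction n rule: less_induct)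
    case (less n)
    have tm: "fps_nth W i * fps_nth W (n - i) = 0" if "odd i \<or> odd (n - i) \<or> i = 0 \<or> i = n" "i \<le> n" "n > 0" for i
    proof (cases "i = 0 \<or> i = n")
      case True thus ?thesis using W0 by auto
    next
      case False
      with that have "i < n" "n - i < n" by auto
      thus ?thesis using less[of i] less[of "n - i"] that False by force
    qed
    show ?case
    proof (intro conjI impI)
      assume n: "odd n"
      hence "(\<Sum>i=0..n. fps_nth W i * fps_nth W (n - i)) = 0"
        by (intro sum.neutral ballI tm) (auto simp: odd_pos)
      moreover have "n \<noteq> 2" using n by auto
      ultimately have "real (n + 1) * fps_nth W n = 0" using Wrec[of n] by simp
      thus "fps_nth W n = 0" by (simp del: of_nat_Suc of_nat_add)
    next
      assume n: "even n \<and> n > 0"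
      show "(-1) ^ (n div 2) * fps_nth W n > 0"
      proof (cases "n = 2")
        case True
        have "(\<Sum>i=0..n. fps_nth W i * fps_nth W (n - i)) = 0"
          using True by (intro sum.neutral ballI tm) auto
        thus ?thesis using Wrec[of n] True by simp
      next
        case False
        with n have n4: "n \<ge> 4" by (auto elim!: evenE)
        define f where "f i = (-1) ^ (n div 2) * (fps_nth W i * fps_nth W (n - i))" for i
        have pos: "f i > 0" if i: "even i" "i > 0" "i < n" for i
        proof -
          have "n div 2 = i div 2 + (n - i) div 2"
            using i n by (auto elim!: evenE simp: div_mult_self1)
          hence "f i = ((-1) ^ (i div 2) * fps_nth W i) * ((-1) ^ ((n - i) div 2) * fps_nth W (n - i))"
            by (simp add: f_def power_add)
          also have "\<dots> > 0"
            using less[of i] less[of "n - i"] i n by (rule_tac mult_pos_pos) auto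
          finally show ?thesis .
        qed
        have "(\<Sum>i=0..n. f i) > 0"
        proof (rule sum_pos2[of _ 2])
          fix i assume i: "i \<in> {0..n}"
          show "f i \<ge> 0"
          proof (cases "even i \<and> i > 0 \<and> i < n")
            case True thus ?thesis using pos[of i] by simp
          next
            case False thus ?thesis using tm[of i] i n by (auto simp: f_def)
          qed
        qed (use n4 pos[of 2] in auto)
        also have "(\<Sum>i=0..n. f i) = (-1) ^ (n div 2) * (real (n + 1) * fps_nth W n)"
          unfolding Wrec using False by (simp add: f_def sum_distrib_left)
        finally have "real (n + 1) * ((-1) ^ (n div 2) * fps_nth W n) > 0" by (simp add: mult_ac)
        thus ?thesis by (simp add: zero_less_mult_iff)
      qed
    qed
  qed
  \<comment> \<open>The recursion n q_n = sum of q_i w_(n-i) starts from q_0 = 1. For even n the odd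
    i drop out because w has no odd coefficients, and i = n drops out because w_0 = 0.\<close>
  have Qsign: "even n \<longrightarrow> (-1) ^ (n div 2) * fps_nth Q n > 0" for n
  proof (induction n rule: less_induct)
    case (less n)
    show ?case
    proof (cases "n > 0 \<and> even n")
      case False thus ?thesis by (auto simp: Q0)
    next
      case True
      have rec: "real n * fps_nth Q n = (\<Sum>i=0..n. fps_nth Q i * fps_nth W (n - i))"
      proof -
        have "fps_nth (fps_X * fps_deriv Q) n = real n * fps_nth Q n"
          by (cases n) auto
        thus ?thesis by (simp add: QW fps_mult_nth)
      qed
      define f where "f i = (-1) ^ (n div 2) * (fps_nth Q i * fps_nth W (n - i))" for i
      have pos: "f i > 0" if i: "even i" "i < n" for i
      proof -
        have "n div 2 = i div 2 + (n - i) div 2"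
          using i True by (auto elim!: evenE simp: div_mult_self1)
        hence "f i = ((-1) ^ (i div 2) * fps_nth Q i) * ((-1) ^ ((n - i) div 2) * fps_nth W (n - i))"
          by (simp add: f_def power_add)
        also have "\<dots> > 0"
          using less[of i] Wsign[of "n - i"] i True by (rule_tac mult_pos_pos) auto
        finally show ?thesis .
      qed
      have "(\<Sum>i=0..n. f i) > 0"
      proof (rule sum_pos2[of _ 0])
        fix i assume i: "i \<in> {0..n}"
        show "f i \<ge> 0"
        proof (cases "even i \<and> i < n")
          case True thus ?thesis using pos[of i] by simp
        next
          case False
          hence "fps_nth W (n - i) = 0" using True i W0 Wsign[of "n - i"] by auto
          thus ?thesis by (auto simp: f_def)
        qed
      qed (use True pos[of 0] in auto)
      also have "(\<Sum>i=0..n. f i) = (-1) ^ (n div 2) * (real n * fps_nth Q n)"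
        unfolding rec by (simp add: f_def sum_distrib_left)
      finally have "real n * ((-1) ^ (n div 2) * fps_nth Q n) > 0" by (simp add: mult_ac)
      thus ?thesis by (simp add: zero_less_mult_iff)
    qed
  qed
  from Qsign[of m] assms show ?thesis by (auto simp: Q_def even_bern_def)
qed

subsection \<open>The kernel of the digamma function\<close>

text \<open>After division by x^(N+1), the remainder still has a power series expansion; it is
  therefore continuous at 0 and bounded nearby.\<close>

lemma has_fps_expansion_imp_taylor_remainder:
  fixes f :: "'a :: {real_normed_field, banach} \<Rightarrow> 'a"
  assumes "f has_fps_expansion F"
  obtains \<delta> C where "\<delta> > 0" "\<And>x. x \<noteq> 0 \<Longrightarrow> norm x < \<delta> \<Longrightarrow> norm (f x - (\<Sum>n\<le>N. fps_nth F n * x ^ n)) \<le> C * norm x ^ (N + 1)"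
proof -
  define P where "P = (\<Sum>n\<le>N. fps_const (fps_nth F n) * fps_X ^ n)"
  define G where "G = F - P"
  define g where "g x = f x - (\<Sum>n\<le>N. fps_nth F n * x ^ n)" for x
  have g: "g has_fps_expansion G"
    unfolding g_def [abs_def] G_def P_def
    by (intro has_fps_expansion_diff assms has_fps_expansion_sum has_fps_expansion_cmult_left has_fps_expansion_fps_X_power)
  have Pn: "fps_nth P k = (if k \<le> N then fps_nth F k else 0)" for k
    by (simp add: P_def fps_sum_nth fps_X_power_iff if_distrib[of "\<lambda>x. _ * x"] cong: if_cong)
  define h where "h x = (if x = 0 then fps_nth G (N+1) else g x / x ^ (N + 1))" for x
  have "continuous (at 0) h"
  proof (cases "G = 0")
    case False
    hence "subdegree G \<ge> N + 1"
      using False by (intro subdegree_geI) (simp_all add: G_def Pn)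
    hence "h has_fps_expansion fps_shift (N + 1) G"
      unfolding h_def [abs_def] by (intro has_fps_expansion_shift g) auto
    thus ?thesis by (rule has_fps_expansion_imp_continuous)
  next
    \<comment> \<open>The zero series is treated apart because its \<open>subdegree\<close> is 0 by
      convention, so the shift argument does not cover it.\<close>
    case True
    have "eventually (\<lambda>x. g x = 0) (nhds 0)"
      using g True by (auto simp: has_fps_expansion_def elim: eventually_mono)
    hence "eventually (\<lambda>x. h x = 0) (nhds 0)"
      by eventually_elim (auto simp: h_def True)
    thus ?thesis by (subst isCont_cong[where g = "\<lambda>_. 0"]) auto
  qed
  hence "eventually (\<lambda>x. dist (h x) (h 0) < 1) (at 0)"
    unfolding isCont_def by (rule tendstoD) auto
  then obtain d where d: "d > 0" "\<And>x. x \<noteq> 0 \<Longrightarrow> dist x 0 < d \<Longrightarrow> dist (h x) (h 0) < 1"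
    by (auto simp: eventually_at)
  show ?thesis
  proof (rule that[OF d(1)])
    fix x :: 'a assume x: "x \<noteq> 0" "norm x < d"
    have "norm (h x) \<le> norm (h 0) + norm (h x - h 0)" by norm
    also have "\<dots> \<le> norm (h 0) + 1" using d(2)[of x] x by (simp add: dist_norm less_imp_le)
    finally have "norm (h x) * norm x ^ (N+1) \<le> (norm (h 0) + 1) * norm x ^ (N+1)"
      by (intro mult_right_mono) auto
    thus "norm (f x - (\<Sum>n\<le>N. fps_nth F n * x ^ n)) \<le> (norm (h 0) + 1) * norm x ^ (N+1)"
      using x by (simp add: h_def g_def norm_divide norm_power norm_mult)
  qed
qed

text \<open>The quotient is the geometric series of exp(-(1/4 + k) u) and also equals exp(3u/4)/(exp
  u - 1); this is how the argument 3/4 of the Bernoulli polynomials arises. Subtracting 1/u removes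
  the singularity at 0.\<close>

definition digamma_kernel :: "real \<Rightarrow> real" where
  "digamma_kernel u = exp (- u / 4) / (1 - exp (- u)) - 1 / u"

text \<open>The kernel is the Bernoulli generating function divided by u, hence the shift:
  coefficient n belongs to u^(n-1), the term n = 0 is the subtracted 1/u, and the polynomial has
  degree below N.\<close>

definition digamma_kernel_rem :: "nat \<Rightarrow> real \<Rightarrow> real" where
  "digamma_kernel_rem N u = digamma_kernel u - (\<Sum>n=1..N. bernpoly n (3/4) / fact n * u ^ (n - 1))"

text \<open>Near 0 this is Taylor's estimate. Away from 0 the kernel is bounded and the polynomial
  has degree below N, so u^N dominates both. That the bound holds on the whole half-line is what
  later yields estimates for all x > 0.\<close>

lemma digamma_kernel_rem_bound:
  obtains C where "C \<ge> 0" "\<And>u. u > 0 \<Longrightarrow> \<bar>digamma_kernel_rem N u\<bar> \<le> C * u ^ N"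
proof -
  define b where "b n = bernpoly n (3/4) / fact n" for n
  define F :: "real fps" where "F = fps_X * fps_exp (3/4) / (fps_exp 1 - 1)"
  have bF: "fps_nth F n = b n" for n by (simp add: F_def b_def bernpoly_def)
  have sub: "subdegree (fps_exp 1 - 1 :: real fps) = 1"
    by (rule subdegreeI) (auto simp: less_Suc_eq)
  define f where "f x = (if x = 0 then 1 else x * exp (3/4 * x) / (exp (1 * x) - 1))" for x :: real
  have f: "f has_fps_expansion F"
    unfolding f_def [abs_def] F_def
  proof (intro has_fps_expansion_divide has_fps_expansion_mult has_fps_expansion_diff has_fps_expansion_exp has_fps_expansion_fps_X has_fps_expansion_1)
    show "subdegree (fps_exp 1 - 1 :: real fps) \<le> subdegree (fps_X * fps_exp (3/4) :: real fps)"
      unfolding sub by (intro subdegree_geI) (auto simp: fps_eq_iff intro!: exI[of _ 1])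
    show "(fps_exp 1 - 1 :: real fps) \<noteq> 0" using sub by auto
    show "(1::real) = fps_nth (fps_X * fps_exp (3/4)) (subdegree (fps_exp 1 - 1 :: real fps)) /
        fps_nth (fps_exp 1 - 1) (subdegree (fps_exp 1 - 1 :: real fps))"
      unfolding sub by simp
  qed
  \<comment> \<open>This coefficient produces exactly the 1/u that \<open>digamma_kernel\<close>
    subtracts.\<close>
  have b0: "b 0 = 1"
  proof -
    have "eventually (\<lambda>z. eval_fps F z = f z) (nhds 0)" using f by (simp add: has_fps_expansion_def)
    hence "eval_fps F 0 = f 0" by (rule eventually_nhds_x_imp_x)
    thus ?thesis by (simp add: f_def eval_fps_at_0 bF)
  qed
  obtain \<delta> C where \<delta>: "\<delta> > 0" and C: "\<And>x. x \<noteq> 0 \<Longrightarrow> norm x < \<delta> \<Longrightarrow> norm (f x - (\<Sum>n\<le>N. fps_nth F n * x ^ n)) \<le> C * norm x ^ (N + 1)"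
    using has_fps_expansion_imp_taylor_remainder[OF f, of N] by metis
  have small: "\<bar>digamma_kernel_rem N u\<bar> \<le> C * u ^ N" if u: "u > 0" "u < \<delta>" for u
  proof -
    have e1: "exp (- u / 4) / (1 - exp (- u)) = f u / u"
    proof -
      have "exp (- u / 4) / (1 - exp (- u)) = (exp (- u/4) * exp u) / ((1 - exp (- u)) * exp u)"
        by simp
      also have "exp (- u/4) * exp u = exp (3/4 * u)" by (simp flip: exp_add)
      also have "(1 - exp (-u)) * exp u = exp u - 1" by (simp add: algebra_simps flip: exp_add)
      finally show ?thesis using u by (simp add: f_def)
    qed
    have e2: "(\<Sum>n\<le>N. b n * u ^ n) = 1 + u * (\<Sum>n=1..N. b n * u ^ (n - 1))"
    proof -
      have "{..N} = insert 0 {1..N}" by auto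
      hence "(\<Sum>n\<le>N. b n * u ^ n) = 1 + (\<Sum>n=1..N. b n * u ^ n)" by (simp add: b0)
      also have "(\<Sum>n=1..N. b n * u ^ n) = (\<Sum>n=1..N. u * (b n * u ^ (n - 1)))"
        by (intro sum.cong) (auto simp: power_eq_if)
      finally show ?thesis by (simp add: sum_distrib_left)
    qed
    have "digamma_kernel_rem N u = (f u - (\<Sum>n\<le>N. b n * u ^ n)) / u"
      unfolding digamma_kernel_rem_def digamma_kernel_def b_def[symmetric] e1 e2
      using u by (simp add: diff_divide_distrib add_divide_distrib)
    also have "\<bar>\<dots>\<bar> \<le> C * u ^ (N + 1) / u"
      using C[of u] u by (simp add: bF pos_divide_le_eq mult_ac)
    finally show ?thesis using u by simp
  qed
  have pow: "u ^ k \<le> \<delta> powr (- real (N - k)) * u ^ N" if "u \<ge> \<delta>" "k \<le> N" for u k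
  proof -
    have "u ^ k * \<delta> ^ (N - k) \<le> u ^ k * u ^ (N - k)"
      using that \<delta> by (intro mult_left_mono power_mono) auto
    also have "\<dots> = u ^ N" using that by (simp flip: power_add)
    finally show ?thesis using \<delta> by (simp add: powr_minus powr_realpow field_simps)
  qed
  \<comment> \<open>By \<open>pow\<close>, u^k is at most \<delta>^(k-N) u^N for u \<ge> \<delta>;
    \<open>D\<close> adds these factors, weighted by a bound for the kernel and by the
    coefficients.\<close>
  define D where "D = (1 / (1 - exp (- \<delta>)) + 1 / \<delta>) * \<delta> powr (- real (N - 0)) +
     (\<Sum>n=1..N. \<bar>b n\<bar> * \<delta> powr (- real (N - (n - 1))))"
  have D0: "D \<ge> 0" using \<delta> by (auto simp: D_def intro!: add_nonneg_nonneg sum_nonneg mult_nonneg_nonneg)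
  have large: "\<bar>digamma_kernel_rem N u\<bar> \<le> D * u ^ N" if u: "u \<ge> \<delta>" for u
  proof -
    have "\<bar>digamma_kernel u\<bar> \<le> exp (- u / 4) / (1 - exp (- u)) + 1 / u"
      using u \<delta> by (auto simp: digamma_kernel_def intro!: order.trans[OF abs_triangle_ineq4])
    also have "\<dots> \<le> 1 / (1 - exp (- \<delta>)) + 1 / \<delta>"
      using u \<delta> by (intro add_mono frac_le) auto
    also have "\<dots> \<le> (1 / (1 - exp (- \<delta>)) + 1 / \<delta>) * (\<delta> powr (- real (N - 0)) * u ^ N)"
      using pow[of u 0] u \<delta> mult_left_mono[of 1 "\<delta> powr (- real (N - 0)) * u ^ N" "1 / (1 - exp (- \<delta>)) + 1 / \<delta>"]
      by (simp add: add_nonneg_nonneg)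
    finally have k: "\<bar>digamma_kernel u\<bar> \<le> (1 / (1 - exp (- \<delta>)) + 1 / \<delta>) * \<delta> powr (- real (N - 0)) * u ^ N" by simp
    have "\<bar>\<Sum>n=1..N. b n * u ^ (n - 1)\<bar> \<le> (\<Sum>n=1..N. \<bar>b n * u ^ (n - 1)\<bar>)" by (rule sum_abs)
    also have "\<dots> \<le> (\<Sum>n=1..N. \<bar>b n\<bar> * (\<delta> powr (- real (N - (n - 1))) * u ^ N))"
    proof (rule sum_mono)
      fix n assume n: "n \<in> {1..N}"
      hence "n - 1 \<le> N" by auto
      have "\<bar>b n * u ^ (n - 1)\<bar> = \<bar>b n\<bar> * u ^ (n - 1)"
        using u \<delta> by (simp add: abs_mult)
      also have "\<dots> \<le> \<bar>b n\<bar> * (\<delta> powr (- real (N - (n - 1))) * u ^ N)"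
        by (rule mult_left_mono[OF pow[OF u \<open>n - 1 \<le> N\<close>]]) simp
      finally show "\<bar>b n * u ^ (n - 1)\<bar> \<le> \<bar>b n\<bar> * (\<delta> powr (- real (N - (n - 1))) * u ^ N)" .
    qed
    finally have "\<bar>\<Sum>n=1..N. b n * u ^ (n - 1)\<bar> \<le> (\<Sum>n=1..N. \<bar>b n\<bar> * \<delta> powr (- real (N - (n - 1)))) * u ^ N"
      by (simp only: sum_distrib_right mult.assoc)
    with k show ?thesis
      unfolding digamma_kernel_rem_def D_def b_def[symmetric] distrib_right by linarith
  qed
  show ?thesis
  proof (rule that[of "max C D"])
    show "max C D \<ge> 0" using D0 by auto
    fix u :: real assume u: "u > 0"
    have "\<bar>digamma_kernel_rem N u\<bar> \<le> C * u ^ N \<or> \<bar>digamma_kernel_rem N u\<bar> \<le> D * u ^ N"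
      using small[of u] large[of u] u by linarith
    moreover have "C * u ^ N \<le> max C D * u ^ N" "D * u ^ N \<le> max C D * u ^ N"
      using u by (auto intro!: mult_right_mono)
    ultimately show "\<bar>digamma_kernel_rem N u\<bar> \<le> max C D * u ^ N" by linarith
  qed
qed


subsection \<open>Gamma and Frullani type integrals\<close>

text \<open>Substitution of t = c u^p in Euler's integral. The case p = 2 gives Gaussian moments, p
  = 1 Laplace integrals; the Frullani integral below compares the two.\<close>

lemma has_bochner_integral_powr_exp:
  fixes s p c :: real
  assumes s: "s > 0" and p: "p > 0" and c: "c > 0"
  shows "has_bochner_integral lborel (\<lambda>u. indicator {0<..} u * (u powr (s - 1) * exp (- c * u powr p)))
           (Gamma (s / p) * c powr (- s / p) / p)"
proof -
  define f where "f t = t powr (s / p - 1) / exp t" for t :: real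
  define g where "g u = c * u powr p" for u :: real
  have f: "(f has_integral Gamma (s / p)) {0<..}"
  proof -
    have "(f has_integral Gamma (s / p)) {0..}"
      unfolding f_def using s p by (intro Gamma_integral_real) auto
    moreover have "negligible {x \<in> {0..} - {0<..}. f x \<noteq> 0}"
      by (rule negligible_subset[of "{0}"]) auto
    moreover have "negligible {x \<in> {0<..} - {0..}. f x \<noteq> 0}"
      by (rule negligible_subset[of "{0}"]) auto
    ultimately show ?thesis
      using has_integral_spike_set_eq[of "{0..}" "{0<..}" f "Gamma (s / p)"] by simp
  qed
  hence fa: "f absolutely_integrable_on {0<..}" "integral {0<..} f = Gamma (s / p)"
    by (auto intro!: nonnegative_absolutely_integrable_1 simp: has_integral_iff f_def)
  have img: "g ` {0<..} = {0<..}"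
  proof -
    have "y \<in> g ` {0<..}" if "y > 0" for y
      using that c p by (intro image_eqI[of _ _ "(y / c) powr (1 / p)"]) (auto simp: g_def powr_powr)
    thus ?thesis using c by (auto simp: g_def)
  qed
  have inj: "inj_on g {0<..}"
    using c p by (auto simp: inj_on_def g_def powr_def)
  have der: "(g has_field_derivative (c * p * u powr (p - 1))) (at u within {0<..})" if "u \<in> {0<..}" for u
    using that unfolding g_def by (auto intro!: derivative_eq_intros)
  have "(\<lambda>u. \<bar>c * p * u powr (p - 1)\<bar> * f (g u)) absolutely_integrable_on {0<..} \<and>
        integral {0<..} (\<lambda>u. \<bar>c * p * u powr (p - 1)\<bar> * f (g u)) = Gamma (s / p)"
    using has_absolute_integral_change_of_variables_1'[of "{0<..}" g "\<lambda>u. c * p * u powr (p - 1)" f "Gamma (s / p)"]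
      fa img inj der by simp
  hence "((\<lambda>u. \<bar>c * p * u powr (p - 1)\<bar> * f (g u)) has_integral Gamma (s / p)) {0<..}"
    by (simp add: has_integral_iff set_lebesgue_integral_eq_integral)
  hence "((\<lambda>u. (c powr (- s / p) / p) * (\<bar>c * p * u powr (p - 1)\<bar> * f (g u))) has_integral (c powr (- s / p) / p) * Gamma (s / p)) {0<..}"
    by (rule has_integral_mult_right)
  also have "?this \<longleftrightarrow> ((\<lambda>u. u powr (s - 1) * exp (- c * u powr p)) has_integral (c powr (- s / p) / p) * Gamma (s / p)) {0<..}"
  proof (rule has_integral_cong)
    fix u :: real assume "u \<in> {0<..}"
    hence u: "u > 0" by simp
    have "(u powr p) powr (s / p - 1) = u powr (s - p)"
      using p by (simp add: powr_powr right_diff_distrib)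
    hence "f (g u) = c powr (s / p - 1) * u powr (s - p) * exp (- c * u powr p)"
      using u c p by (simp add: f_def g_def powr_mult exp_minus divide_inverse)
    hence "(c powr (- s / p) / p) * (\<bar>c * p * u powr (p - 1)\<bar> * f (g u)) =
       (c powr (- s / p) * c powr 1 * c powr (s / p - 1)) * (u powr (p - 1) * u powr (s - p)) * exp (- c * u powr p)"
      using u c p by (simp add: abs_mult)
    also have "c powr (- s / p) * c powr 1 * c powr (s / p - 1) = 1"
      using c by (simp only: powr_add[symmetric]) simp
    also have "u powr (p - 1) * u powr (s - p) = u powr (s - 1)"
      by (simp flip: powr_add)
    finally show "(c powr (- s / p) / p) * (\<bar>c * p * u powr (p - 1)\<bar> * f (g u)) = u powr (s - 1) * exp (- c * u powr p)"
      by simp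
  qed
  finally have I: "((\<lambda>u. u powr (s - 1) * exp (- c * u powr p)) has_integral (c powr (- s / p) / p) * Gamma (s / p)) {0<..}" .
  have "has_bochner_integral lborel (\<lambda>u. indicator {0<..} u * (u powr (s - 1) * exp (- c * u powr p)))
           ((c powr (- s / p) / p) * Gamma (s / p))"
  proof (rule has_bochner_integral_nn_integral)
    show "(\<integral>\<^sup>+ x. ennreal (indicator {0<..} x * (x powr (s - 1) * exp (- c * x powr p))) \<partial>lborel) =
            ennreal ((c powr (- s / p) / p) * Gamma (s / p))"
      by (rule nn_integral_has_integral_lebesgue[OF _ I]) auto
    show "0 \<le> (c powr (- s / p) / p) * Gamma (s / p)"
      using s p c by (auto intro!: mult_nonneg_nonneg less_imp_le[OF Gamma_real_pos])
  qed auto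
  thus ?thesis by (simp add: mult_ac)
qed

lemma has_bochner_integral_power_exp_square:
  fixes c :: real
  assumes c: "c > 0"
  shows "has_bochner_integral lborel (\<lambda>u. indicator {0<..} u * (u ^ n * exp (- c * u\<^sup>2)))
           (Gamma (real (n + 1) / 2) * c powr (- real (n + 1) / 2) / 2)"
proof -
  have "(\<lambda>u. indicator {0<..} u * (u ^ n * exp (- c * u\<^sup>2))) =
        (\<lambda>u. indicator {0<..} u * (u powr (real (n+1) - 1) * exp (- c * u powr 2)))"
    by (rule ext) (auto simp: indicator_def powr_realpow)
  thus ?thesis
    using has_bochner_integral_powr_exp[of "real (n+1)" 2 c] assms by simp
qed

lemma diff_exp_minus_le:
  fixes p q :: real
  assumes "p \<ge> 0" "q \<ge> 0"
  shows   "\<bar>exp (- p) - exp (- q)\<bar> \<le> \<bar>p - q\<bar>"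
proof -
  have *: "exp (- p) - exp (- q) \<le> q - p" if "0 \<le> p" "p \<le> q" for p q :: real
  proof -
    have "exp (- p) - exp (- q) = exp (- p) * (1 - exp (p - q))"
      by (simp add: algebra_simps flip: exp_add)
    also have "\<dots> \<le> 1 * (q - p)"
    proof (rule mult_mono)
      show "1 - exp (p - q) \<le> q - p" using exp_ge_add_one_self[of "p - q"] by linarith
    qed (use that in auto)
    finally show ?thesis by simp
  qed
  have "exp (- p) \<le> exp (- q) \<longleftrightarrow> q \<le> p" by simp
  thus ?thesis using *[of p q] *[of q p] assms by (cases "p \<le> q") auto
qed

text \<open>The numerator vanishes at 0, so 1/u becomes integrable. The Gaussian is inherited from
  the integral over t, the exponential from the end of the geometric sum.\<close>

definition frullani_quot :: "real \<Rightarrow> real \<Rightarrow> real \<Rightarrow> real" where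
  "frullani_quot \<alpha> \<beta> u = (exp (- \<alpha> * u\<^sup>2) - exp (- \<beta> * u)) / u"

text \<open>The weight 1 + u majorises u^s for all 0 < s \<le> 1, so one integrable function
  dominates the whole family used for the limit s -> 0.\<close>

lemma frullani_quot_bound:
  assumes "\<alpha> > 0" "\<beta> > 0"
  obtains C where "C \<ge> 0" "\<And>u. u > 0 \<Longrightarrow> (1 + u) * \<bar>frullani_quot \<alpha> \<beta> u\<bar> \<le> C * (exp (- \<alpha> * u\<^sup>2) + exp (- \<beta> * u))"
proof -
  \<comment> \<open>On (0, 1] the quotient is at most \<alpha> + \<beta> and the weight at most 2;
    \<open>exp \<beta>\<close> compensates for exp(-\<beta> u) \<ge> exp(-\<beta>).\<close>
  define D where "D = 2 * (\<alpha> + \<beta>) * exp \<beta>"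
  have D: "D \<ge> 0" using assms by (simp add: D_def)
  have "(1 + u) * \<bar>frullani_quot \<alpha> \<beta> u\<bar> \<le> (2 + D) * (exp (- \<alpha> * u\<^sup>2) + exp (- \<beta> * u))" if u: "u > 0" for u
  proof (cases "u \<le> 1")
    case True
    have "\<bar>frullani_quot \<alpha> \<beta> u\<bar> \<le> \<bar>\<alpha> * u\<^sup>2 - \<beta> * u\<bar> / u"
      using diff_exp_minus_le[of "\<alpha> * u\<^sup>2" "\<beta> * u"] assms u by (simp add: frullani_quot_def divide_right_mono)
    also have "\<dots> = \<bar>\<alpha> * u - \<beta>\<bar>"
    proof -
      have "\<alpha> * u\<^sup>2 - \<beta> * u = u * (\<alpha> * u - \<beta>)" by (simp add: algebra_simps power2_eq_square)
      thus ?thesis using u by (simp add: abs_mult)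
    qed
    also have "\<dots> \<le> \<alpha> + \<beta>"
    proof -
      have "\<alpha> * u \<le> \<alpha>" "0 \<le> \<alpha> * u" using True u assms by (auto simp: mult_left_le)
      thus ?thesis using assms by linarith
    qed
    finally have "(1 + u) * \<bar>frullani_quot \<alpha> \<beta> u\<bar> \<le> 2 * (\<alpha> + \<beta>)"
      using True u assms by (intro mult_mono) auto
    also have "\<dots> = D * exp (- \<beta>)" by (simp add: D_def exp_minus)
    also have "\<dots> \<le> (2 + D) * exp (- \<beta> * u)"
      using True u assms D by (intro mult_mono) auto
    also have "\<dots> \<le> (2 + D) * (exp (- \<alpha> * u\<^sup>2) + exp (- \<beta> * u))"
      using D by (intro mult_left_mono) auto
    finally show ?thesis .
  next
    case False
    have "(1 + u) * \<bar>frullani_quot \<alpha> \<beta> u\<bar> \<le> (2 * u) * \<bar>frullani_quot \<alpha> \<beta> u\<bar>"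
      using False by (intro mult_right_mono) auto
    also have "\<dots> = 2 * \<bar>exp (- \<alpha> * u\<^sup>2) - exp (- \<beta> * u)\<bar>"
      using u by (simp add: frullani_quot_def)
    also have "\<dots> \<le> 2 * (exp (- \<alpha> * u\<^sup>2) + exp (- \<beta> * u))"
      by (intro mult_left_mono) (auto intro!: order.trans[OF abs_triangle_ineq4])
    also have "\<dots> \<le> (2 + D) * (exp (- \<alpha> * u\<^sup>2) + exp (- \<beta> * u))"
      using D by (intro mult_right_mono add_nonneg_nonneg) auto
    finally show ?thesis .
  qed
  thus ?thesis using D by (intro that[of "2 + D"]) auto
qed

lemma integrable_exp_square_exp:
  assumes "\<alpha> > 0" "\<beta> > 0"
  shows "integrable lborel (\<lambda>u. indicator {0<..} u * (C * (exp (- \<alpha> * u\<^sup>2) + exp (- \<beta> * u))) :: real)"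
proof -
  have "integrable lborel (\<lambda>u. indicator {0<..} u * (u powr (1 - 1) * exp (- \<alpha> * u powr 2)) :: real)"
    using has_bochner_integral_powr_exp[of 1 2 \<alpha>] assms by (auto simp: has_bochner_integral_iff)
  moreover have "integrable lborel (\<lambda>u. indicator {0<..} u * (u powr (1 - 1) * exp (- \<beta> * u powr 1)) :: real)"
    using has_bochner_integral_powr_exp[of 1 1 \<beta>] assms by (auto simp: has_bochner_integral_iff)
  ultimately have "integrable lborel (\<lambda>u. C * (indicator {0<..} u * (u powr (1 - 1) * exp (- \<alpha> * u powr 2)) +
      indicator {0<..} u * (u powr (1 - 1) * exp (- \<beta> * u powr 1))) :: real)"
    by (intro integrable_mult_right integrable_add) auto
  thus ?thesis
    by (rule Bochner_Integration.integrable_cong[THEN iffD1, rotated 2]) (auto simp: indicator_def)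
qed

text \<open>
  Inserting a factor \<open>u powr s\<close> turns the integral into a difference of Gamma values with a removable
  singularity at \<open>s = 0\<close>; the limit \<open>s \<rightarrow> 0\<close> is a derivative involving \<open>\<Gamma>'(1) = -C\<^sub>0\<close>.
\<close>

lemma has_bochner_integral_frullani_quot:
  assumes \<alpha>: "\<alpha> > 0" and \<beta>: "\<beta> > 0"
  shows "has_bochner_integral lborel (\<lambda>u. indicator {0<..} u * frullani_quot \<alpha> \<beta> u)
            (ln \<beta> - ln \<alpha> / 2 + euler_mascheroni / 2)"
proof -
  obtain C where C: "C \<ge> 0" "\<And>u. u > 0 \<Longrightarrow> (1 + u) * \<bar>frullani_quot \<alpha> \<beta> u\<bar> \<le> C * (exp (- \<alpha> * u\<^sup>2) + exp (- \<beta> * u))"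
    using frullani_quot_bound[OF assms] by metis
  define w where "w u = indicator {0<..} u * (C * (exp (- \<alpha> * u\<^sup>2) + exp (- \<beta> * u)))" for u :: real
  have w: "integrable lborel w"
    unfolding w_def by (rule integrable_exp_square_exp[OF assms])
  define s where "s k = 1 / real (Suc k)" for k
  have s: "s k > 0" "s k \<le> 1" for k by (auto simp: s_def)
  have slim: "s \<longlonglongrightarrow> 0" unfolding s_def by real_asymp
  define F where "F k u = indicator {0<..} u * (u powr s k * frullani_quot \<alpha> \<beta> u)" for k u
  have [measurable]: "frullani_quot \<alpha> \<beta> \<in> borel_measurable borel" by (simp add: frullani_quot_def [abs_def])
  have bound: "AE u in lborel. norm (F k u) \<le> w u" for k
  proof (rule AE_I2)
    fix u :: real
    show "norm (F k u) \<le> w u"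
    proof (cases "u > 0")
      case u: True
      have "u powr s k \<le> 1 + u"
      proof (cases "u \<le> 1")
        case True thus ?thesis using u s[of k] powr_le_one_le[of u "s k"] powr_mono2[of "s k" u 1] by simp
      next
        case False thus ?thesis using s[of k] powr_mono[of "s k" 1 u] by simp
      qed
      hence "\<bar>F k u\<bar> \<le> (1 + u) * \<bar>frullani_quot \<alpha> \<beta> u\<bar>"
        using u by (auto simp: F_def abs_mult intro!: mult_right_mono)
      also have "\<dots> \<le> w u" using C(2)[OF u] u by (simp add: w_def)
      finally show ?thesis by simp
    qed (auto simp: F_def w_def)
  qed
  have lim: "AE u in lborel. (\<lambda>k. F k u) \<longlonglongrightarrow> indicator {0<..} u * frullani_quot \<alpha> \<beta> u"
  proof (rule AE_I2)
    fix u :: real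
    show "(\<lambda>k. F k u) \<longlonglongrightarrow> indicator {0<..} u * frullani_quot \<alpha> \<beta> u"
    proof (cases "u > 0")
      case True
      have "(\<lambda>k. indicator {0<..} u * (u powr s k * frullani_quot \<alpha> \<beta> u)) \<longlonglongrightarrow> indicator {0<..} u * (u powr 0 * frullani_quot \<alpha> \<beta> u)"
        using True by (intro tendsto_intros slim) auto
      thus ?thesis using True by (simp add: F_def)
    qed (auto simp: F_def)
  qed
  have m: "F k \<in> borel_measurable lborel" "(\<lambda>u. indicator {0<..} u * frullani_quot \<alpha> \<beta> u) \<in> borel_measurable lborel" for k
    unfolding F_def [abs_def] by measurable
  have conv: "(\<lambda>k. integral\<^sup>L lborel (F k)) \<longlonglongrightarrow> (LINT u|lborel. indicator {0<..} u * frullani_quot \<alpha> \<beta> u)"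
    using integral_dominated_convergence[OF m(2,1) w lim bound] by simp
  have int: "integrable lborel (\<lambda>u. indicator {0<..} u * frullani_quot \<alpha> \<beta> u)"
    using integrable_dominated_convergence[OF m(2,1) w lim bound] by simp
  \<comment> \<open>By Gamma(s) = Gamma(1 + s)/s the Gamma poles at 0 turn into the denominator s.
    Both terms of the numerator equal 1 at s = 0, so \<open>V\<close> is the difference quotient of
    the numerator at 0.\<close>
  define V where "V s = (\<alpha> powr (- s / 2) * Gamma (1 + s / 2) - \<beta> powr (- s) * Gamma (1 + s)) / s" for s :: real
  have npos: "x \<notin> \<int>\<^sub>\<le>\<^sub>0" if "x > 0" for x :: real
    using that by (auto elim!: nonpos_Ints_cases)
  have val: "integral\<^sup>L lborel (F k) = V (s k)" for k
  proof -
    have "has_bochner_integral lborel (\<lambda>u. indicator {0<..} u * (u powr (s k - 1) * exp (- \<alpha> * u powr 2)) -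
         indicator {0<..} u * (u powr (s k - 1) * exp (- \<beta> * u powr 1)))
         (Gamma (s k / 2) * \<alpha> powr (- s k / 2) / 2 - Gamma (s k / 1) * \<beta> powr (- s k / 1) / 1)"
      using s[of k] \<alpha> \<beta> by (intro has_bochner_integral_diff has_bochner_integral_powr_exp) auto
    hence "integral\<^sup>L lborel (\<lambda>u. indicator {0<..} u * (u powr (s k - 1) * exp (- \<alpha> * u powr 2)) -
         indicator {0<..} u * (u powr (s k - 1) * exp (- \<beta> * u powr 1))) =
         (Gamma (s k / 2) * \<alpha> powr (- s k / 2) / 2 - Gamma (s k) * \<beta> powr (- s k))"
      by (simp add: has_bochner_integral_iff)
    also have "(\<lambda>u. indicator {0<..} u * (u powr (s k - 1) * exp (- \<alpha> * u powr 2)) -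
         indicator {0<..} u * (u powr (s k - 1) * exp (- \<beta> * u powr 1))) = F k"
      by (rule ext) (auto simp: F_def frullani_quot_def indicator_def powr_diff field_simps)
    also have "Gamma (s k / 2) = Gamma (1 + s k / 2) / (s k / 2)"
      using s[of k] Gamma_plus1[of "s k / 2"] npos[of "s k / 2"] by (simp add: add.commute field_simps)
    also have "Gamma (s k) = Gamma (1 + s k) / s k"
      using s[of k] Gamma_plus1[of "s k"] npos[of "s k"] by (simp add: add.commute field_simps)
    finally show ?thesis by (simp add: V_def diff_divide_distrib mult_ac)
  qed
  have "((\<lambda>x. \<alpha> powr (- x / 2) * Gamma (1 + x / 2) - \<beta> powr (- x) * Gamma (1 + x)) has_real_derivative
          (ln \<beta> - ln \<alpha> / 2 + euler_mascheroni / 2)) (at 0)"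
    using \<alpha> \<beta> by (auto intro!: derivative_eq_intros simp: field_simps)
  hence "V \<midarrow>0\<rightarrow> (ln \<beta> - ln \<alpha> / 2 + euler_mascheroni / 2)"
    using \<alpha> \<beta> by (simp add: DERIV_def V_def [abs_def])
  moreover have "filterlim s (at 0) sequentially"
    using slim s by (auto simp: filterlim_at s_def)
  ultimately have "(\<lambda>k. V (s k)) \<longlonglongrightarrow> (ln \<beta> - ln \<alpha> / 2 + euler_mascheroni / 2)"
    by (rule filterlim_compose)
  with conv have "(LINT u|lborel. indicator {0<..} u * frullani_quot \<alpha> \<beta> u) = ln \<beta> - ln \<alpha> / 2 + euler_mascheroni / 2"
    unfolding val by (rule LIMSEQ_unique)
  with int show ?thesis by (simp add: has_bochner_integral_iff)
qed


subsection \<open>The function \<open>\<Psi>\<close>\<close>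

lemma Re_pos_nonpos_Ints: "Re z > 0 \<Longrightarrow> z \<notin> \<int>\<^sub>\<le>\<^sub>0"
  by (auto elim!: nonpos_Ints_cases)

lemma sin_pi_times_nonzero:
  fixes z :: complex
  assumes "z \<notin> \<int>"
  shows   "sin (of_real pi * z) \<noteq> 0"
proof
  assume "sin (of_real pi * z) = 0"
  then obtain n :: int where "of_real pi * z = of_real (of_int n * pi)"
    by (auto simp: sin_eq_0)
  hence "z = of_int n" by simp
  with assms show False by simp
qed

text \<open>Gamma(w) Gamma(1 - w) sin(pi w) is constant on the open strip, so its derivative
  vanishes; dividing out the nonzero Gamma factors leaves the identity.\<close>

lemma Digamma_reflection:
  fixes z :: complex
  assumes z: "0 < Re z" "Re z < 1"
  shows   "Digamma (1 - z) - Digamma z = of_real pi * cot (of_real pi * z)"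
proof -
  have nz: "z \<notin> \<int>\<^sub>\<le>\<^sub>0" "1 - z \<notin> \<int>\<^sub>\<le>\<^sub>0" using z by (auto intro!: Re_pos_nonpos_Ints)
  have "z \<notin> \<int>" using z by (auto elim!: Ints_cases)
  hence s0: "sin (of_real pi * z) \<noteq> 0"
    by (rule sin_pi_times_nonzero)
  have G: "Gamma w * Gamma (1 - w) * sin (of_real pi * w) = of_real pi"
    if "w \<in> {w. 0 < Re w \<and> Re w < 1}" for w :: complex
  proof -
    have "w \<notin> \<int>" using that by (auto elim!: Ints_cases)
    hence "sin (of_real pi * w) \<noteq> 0"
      by (rule sin_pi_times_nonzero)
    thus ?thesis by (simp add: Gamma_reflection_complex)
  qed
  have op: "open {w. 0 < Re w \<and> Re w < 1}"
    by (intro open_Collect_conj open_halfspace_Re_gt open_halfspace_Re_lt)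
  have "((\<lambda>w. of_real pi) has_field_derivative 0) (at z)" by simp
  hence "((\<lambda>w. Gamma w * Gamma (1 - w) * sin (of_real pi * w)) has_field_derivative 0) (at z)"
    by (rule DERIV_cong_ev[THEN iffD1, rotated -1])
       (use z in \<open>auto intro!: eventually_mono[OF eventually_nhds_in_open[OF op]] simp: G\<close>)
  moreover have "((\<lambda>w. Gamma w * Gamma (1 - w) * sin (of_real pi * w)) has_field_derivative
     Gamma z * Gamma (1 - z) * ((Digamma z - Digamma (1 - z)) * sin (of_real pi * z) + of_real pi * cos (of_real pi * z))) (at z)"
    using nz by (auto intro!: derivative_eq_intros simp: algebra_simps)
  ultimately have "Gamma z * Gamma (1 - z) * ((Digamma z - Digamma (1 - z)) * sin (of_real pi * z) + of_real pi * cos (of_real pi * z)) = 0"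
    using DERIV_unique by blast
  hence "(Digamma z - Digamma (1 - z)) * sin (of_real pi * z) + of_real pi * cos (of_real pi * z) = 0"
    using nz by (simp add: Gamma_eq_zero_iff)
  thus ?thesis using s0 by (simp add: cot_def field_simps)
qed

text \<open>In the limit formula, a partial sum of length 2m splits by parity into two partial sums
  of length m, and ln(2m) = ln 2 + ln m accounts for the constant.\<close>

lemma Digamma_duplication:
  fixes z :: complex
  assumes z: "Re z > 0"
  shows "2 * Digamma z = Digamma (z / 2) + Digamma ((z + 1) / 2) + of_real (2 * ln 2)"
proof -
  have nz: "z \<noteq> 0" using z by auto
  have 1: "(\<lambda>m. of_real (ln (real (2 * m))) - (\<Sum>n<2*m. inverse (z + of_nat n))) \<longlonglongrightarrow> Digamma z"
    using filterlim_compose[OF Digamma_LIMSEQ[OF nz] mult_nat_left_at_top[of 2]] by simp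
  have 2: "(\<lambda>m. (of_real (ln (real m)) - (\<Sum>n<m. inverse (z / 2 + of_nat n))) +
           (of_real (ln (real m)) - (\<Sum>n<m. inverse ((z + 1) / 2 + of_nat n))) + of_real (2 * ln 2)) \<longlonglongrightarrow>
          Digamma (z / 2) + Digamma ((z + 1) / 2) + of_real (2 * ln 2)"
    using z by (intro tendsto_intros Digamma_LIMSEQ) (auto simp: complex_eq_iff)
  have "eventually (\<lambda>m. (of_real (ln (real m)) - (\<Sum>n<m. inverse (z / 2 + of_nat n))) +
           (of_real (ln (real m)) - (\<Sum>n<m. inverse ((z + 1) / 2 + of_nat n))) + of_real (2 * ln 2) =
        2 * (of_real (ln (real (2 * m))) - (\<Sum>n<2*m. inverse (z + of_nat n)))) sequentially"
    using eventually_gt_at_top[of 0]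
  proof eventually_elim
    case (elim m)
    have i1: "inverse (z / 2 + of_nat n) = 2 * inverse (z + of_nat (2 * n))" for n
    proof -
      have "z / 2 + of_nat n = (z + of_nat (2 * n)) / 2" by (simp add: field_simps)
      thus ?thesis by (simp only: inverse_eq_divide) simp
    qed
    have i2: "inverse ((z + 1) / 2 + of_nat n) = 2 * inverse (z + of_nat (Suc (2 * n)))" for n
    proof -
      have "(z + 1) / 2 + of_nat n = (z + of_nat (Suc (2 * n))) / 2" by (simp add: field_simps)
      thus ?thesis by (simp only: inverse_eq_divide) simp
    qed
    have "(\<Sum>n<2*m. inverse (z + of_nat n)) = (\<Sum>n<m. inverse (z + of_nat (2*n))) + (\<Sum>n<m. inverse (z + of_nat (Suc (2*n))))"
      by (induction m) (simp_all add: algebra_simps)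
    hence "(\<Sum>n<m. inverse (z / 2 + of_nat n)) + (\<Sum>n<m. inverse ((z + 1) / 2 + of_nat n)) =
        2 * (\<Sum>n<2*m. inverse (z + of_nat n))"
      unfolding i1 i2 by (simp only: sum_distrib_left[symmetric] distrib_left)
    moreover have "ln (real (2 * m)) = ln 2 + ln (real m)"
      using elim by (simp add: ln_mult)
    ultimately show ?case by (simp add: algebra_simps)
  qed
  from 2 this have "(\<lambda>m. 2 * (of_real (ln (real (2 * m))) - (\<Sum>n<2*m. inverse (z + of_nat n)))) \<longlonglongrightarrow>
          Digamma (z / 2) + Digamma ((z + 1) / 2) + of_real (2 * ln 2)"
    by (rule Lim_transform_eventually)
  moreover have "(\<lambda>m. 2 * (of_real (ln (real (2 * m))) - (\<Sum>n<2*m. inverse (z + of_nat n)))) \<longlonglongrightarrow> 2 * Digamma z"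
    by (intro tendsto_intros 1)
  ultimately show ?thesis using LIMSEQ_unique by blast
qed

lemma cnj_Digamma: "Re z > 0 \<Longrightarrow> cnj (Digamma z) = Digamma (cnj z)"
proof -
  assume z: "Re z > 0"
  have "(\<lambda>m. cnj (of_real (ln (real m)) - (\<Sum>n<m. inverse (z + of_nat n)))) \<longlonglongrightarrow> cnj (Digamma z)"
    using z by (intro tendsto_cnj Digamma_LIMSEQ) auto
  moreover have "(\<lambda>m. of_real (ln (real m)) - (\<Sum>n<m. inverse (cnj z + of_nat n))) \<longlonglongrightarrow> Digamma (cnj z)"
    using z by (intro Digamma_LIMSEQ) auto
  ultimately show ?thesis
    by (auto dest: LIMSEQ_unique)
qed

text \<open>On the line Re w = pi/4 sine and cosine share the factor 1/sqrt 2, so the real part of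
  the cotangent is (cosh^2 - sinh^2)/(cosh^2 + sinh^2) at pi t/2.\<close>

lemma Re_cot_quarter: "Re (cot (of_real pi * (1 / 4 + \<i> * of_real (t / 2)))) = 1 / cosh (pi * t)"
proof -
  define w where "w = of_real pi * (1 / 4 + \<i> * of_real (t / 2))"
  define y where "y = pi * t / 2"
  have w: "w = of_real (pi / 4) + \<i> * of_real y" by (simp add: w_def y_def algebra_simps)
  have r: "Re w = pi / 4" "Im w = y" by (simp_all add: w)
  have ch: "(exp y + exp (- y)) / 2 = cosh y" "(exp y - exp (- y)) / 2 = sinh y"
    by (simp_all add: cosh_field_def sinh_field_def)
  define q where "q = sqrt 2 / 2"
  have q: "q * q = 1 / 2" by (simp add: q_def)
  have Rs: "Re (sin w) = q * cosh y" "Im (sin w) = q * sinh y"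
    "Re (cos w) = q * cosh y" "Im (cos w) = - (q * sinh y)"
    by (simp_all add: Re_sin Im_sin Re_cos Im_cos r sin_45 cos_45 q_def flip: ch) (simp_all add: field_simps)
  have "Re (cos w / sin w) = (q * q * (cosh y ^ 2 - sinh y ^ 2)) / (q * q * (cosh y ^ 2 + sinh y ^ 2))"
    by (simp add: Re_divide Rs power2_eq_square algebra_simps)
  also have "cosh y ^ 2 - sinh y ^ 2 = 1" by (simp add: cosh_square_eq)
  also have "cosh y ^ 2 + sinh y ^ 2 = cosh (2 * y)" by (simp add: cosh_double)
  finally have "Re (cot w) = 1 / cosh (2 * y)" by (simp add: q cot_def)
  thus ?thesis by (simp add: w_def y_def)
qed

text \<open>With z = 1/4 + it/2, duplication of 1/2 + it = 2z involves z and z + 1/2. The latter is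
  the conjugate of 1 - z, so reflection leads back to z; the price pi/cosh(pi t), halved, cancels
  the hyperbolic term in \<open>Psi\<close>.\<close>

lemma Psi_eq: "Psi t = ln pi - Re (Digamma (1 / 4 + \<i> * of_real (t / 2)))"
proof -
  define z where "z = 1 / 4 + \<i> * complex_of_real (t / 2)"
  have G: "deriv Gamma (1 / 2 + \<i> * of_real t) / Gamma (1 / 2 + \<i> * of_real t) = Digamma (2 * z)"
  proof -
    have 1: "1 / 2 + \<i> * of_real t = 2 * z" by (simp add: z_def)
    have nz: "2 * z \<notin> \<int>\<^sub>\<le>\<^sub>0" by (rule Re_pos_nonpos_Ints) (simp add: z_def)
    hence "deriv Gamma (2 * z) = Gamma (2 * z) * Digamma (2 * z)"
      by (intro DERIV_imp_deriv has_field_derivative_Gamma)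
    thus ?thesis using nz unfolding 1 by (simp add: Gamma_eq_zero_iff)
  qed
  have dup: "2 * Digamma (2 * z) = Digamma z + Digamma (z + 1 / 2) + of_real (2 * ln 2)"
    using Digamma_duplication[of "2 * z"] by (simp add: z_def add_divide_distrib)
  have "cnj (1 - z) = z + 1 / 2" by (simp add: z_def complex_eq_iff)
  hence "Re (Digamma (z + 1 / 2)) = Re (Digamma (1 - z))"
    using arg_cong[OF cnj_Digamma[of "1 - z"], of Re] by (simp add: z_def)
  also have "\<dots> = Re (Digamma z) + Re (of_real pi * cot (of_real pi * z))"
  proof -
    have "Re z = 1 / 4" by (simp add: z_def)
    hence "Digamma (1 - z) = Digamma z + of_real pi * cot (of_real pi * z)"
      using Digamma_reflection[of z] by (simp add: algebra_simps)
    thus ?thesis by simp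
  qed
  also have "Re (of_real pi * cot (of_real pi * z)) = pi / cosh (pi * t)"
    using Re_cot_quarter[of t] by (simp add: z_def)
  finally have refl: "Re (Digamma (z + 1 / 2)) = Re (Digamma z) + pi / cosh (pi * t)" .
  have "2 * Re (Digamma (2 * z)) = 2 * Re (Digamma z) + pi / cosh (pi * t) + 2 * ln 2"
    using arg_cong[OF dup, of Re] refl by simp
  thus ?thesis
    unfolding Psi_def G z_def[symmetric] by (simp add: ln_mult)
qed

text \<open>The summand is the real part of 1/(1/4 + k + it/2).\<close>

definition psi_sum :: "nat \<Rightarrow> real \<Rightarrow> real" where
  "psi_sum n t = ln pi - ln (real n) + (\<Sum>k<n. (1/4 + real k) / ((1/4 + real k)\<^sup>2 + t\<^sup>2 / 4))"

lemma psi_sum_LIMSEQ: "(\<lambda>n. psi_sum n t) \<longlonglongrightarrow> Psi t"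
proof -
  define z where "z = 1 / 4 + \<i> * complex_of_real (t / 2)"
  have "(\<lambda>m. ln pi - Re (of_real (ln (real m)) - (\<Sum>n<m. inverse (z + of_nat n)))) \<longlonglongrightarrow> ln pi - Re (Digamma z)"
    by (intro tendsto_intros Digamma_LIMSEQ) (auto simp: z_def complex_eq_iff)
  also have "(\<lambda>m. ln pi - Re (of_real (ln (real m)) - (\<Sum>n<m. inverse (z + of_nat n)))) = (\<lambda>m. psi_sum m t)"
    by (rule ext) (simp add: psi_sum_def z_def Re_sum inverse_complex.sel power2_eq_square)
  finally show ?thesis by (simp add: Psi_eq z_def)
qed

text \<open>Uniformity in n is what dominated convergence against the Gaussian requires; quadratic
  growth is crude but harmless there. At t = 0 the sequence converges and hence is bounded, and the
  change from t = 0 is controlled by a convergent series.\<close>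

lemma psi_sum_bound:
  obtains C where "C \<ge> 0" "\<And>n t. \<bar>psi_sum n t\<bar> \<le> C * (1 + t\<^sup>2)"
proof -
  have "convergent (\<lambda>n. psi_sum n 0)" using psi_sum_LIMSEQ convergent_def by blast
  hence "Bseq (\<lambda>n. psi_sum n 0)" by (rule convergent_imp_Bseq)
  then obtain K where K: "K > 0" "\<And>n. \<bar>psi_sum n 0\<bar> \<le> K" by (auto simp: Bseq_def)
  \<comment> \<open>With b = 1/4 + k, replacing b^2 by b^2 + t^2/4 in the denominator changes the
    summand by at most t^2/(4 b^3). Below, 64 = 4^3 comes from b \<ge> (k + 1)/4.\<close>
  define c where "c k = 1 / (1/4 + real k) ^ 3" for k
  have "summable c"
  proof (rule summable_comparison_test_ev)
    show "summable (\<lambda>n. 64 * (1 / real (Suc n) ^ 2))"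
    proof (rule summable_mult)
      have "summable (\<lambda>n. 1 / real n ^ 2)"
        using inverse_power_summable[of 2, where 'a = real] by (simp add: inverse_eq_divide power_one_over)
      thus "summable (\<lambda>n. 1 / real (Suc n) ^ 2)"
        by (subst summable_Suc_iff[of "\<lambda>n. 1 / real n ^ 2"])
    qed
    show "eventually (\<lambda>n. norm (c n) \<le> 64 * (1 / real (Suc n) ^ 2)) sequentially"
    proof (intro always_eventually allI)
      fix n :: nat
      have "real (Suc n) ^ 2 \<le> real (Suc n) ^ 3" by (intro power_increasing) auto
      also have "\<dots> \<le> (4 * (1/4 + real n)) ^ 3" by (intro power_mono) auto
      also have "\<dots> = 64 * (1/4 + real n) ^ 3" by (simp only: power_mult_distrib) simp
      finally show "norm (c n) \<le> 64 * (1 / real (Suc n) ^ 2)"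
        by (simp add: c_def divide_simps del: of_nat_Suc)
    qed
  qed
  define D where "D = suminf c"
  have D: "(\<Sum>k<n. c k) \<le> D" for n
    unfolding D_def by (rule sum_le_suminf[OF \<open>summable c\<close>]) (auto simp: c_def)
  have "D \<ge> 0" using D[of 0] by simp
  have "\<bar>psi_sum n t\<bar> \<le> (K + D) * (1 + t\<^sup>2)" for n t
  proof -
    have "\<bar>psi_sum n t - psi_sum n 0\<bar> \<le> (\<Sum>k<n. t\<^sup>2 * c k)"
    proof -
      have eq: "psi_sum n t - psi_sum n 0 = (\<Sum>k<n. (1/4 + real k) / ((1/4 + real k)\<^sup>2 + t\<^sup>2 / 4) - (1/4 + real k) / ((1/4 + real k)\<^sup>2))"
        by (simp add: psi_sum_def sum_subtractf)
      have "\<bar>psi_sum n t - psi_sum n 0\<bar> \<le> (\<Sum>k<n. \<bar>(1/4 + real k) / ((1/4 + real k)\<^sup>2 + t\<^sup>2 / 4) - (1/4 + real k) / ((1/4 + real k)\<^sup>2)\<bar>)"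
        unfolding eq by (rule sum_abs)
      also have "\<dots> \<le> (\<Sum>k<n. t\<^sup>2 * c k)"
      proof (rule sum_mono)
        fix k
        define b where "b = 1/4 + real k"
        have b: "b > 0" by (simp add: b_def)
        define q where "q = b\<^sup>2 + t\<^sup>2 / 4"
        have q: "q \<ge> b\<^sup>2" "q > 0" unfolding q_def using zero_less_power[OF b, of 2] zero_le_power2[of t] by linarith+
        have "b / q - b / b\<^sup>2 = (b\<^sup>2 - q) / (q * b)"
          using b q by (simp add: divide_simps power2_eq_square)
        also have "b\<^sup>2 - q = - (t\<^sup>2 / 4)" by (simp add: q_def)
        finally have "\<bar>b / q - b / b\<^sup>2\<bar> = (t\<^sup>2 / 4) / (q * b)" using b q by simp
        also have "\<dots> \<le> t\<^sup>2 / (b\<^sup>2 * b)"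
          using b q by (intro frac_le mult_right_mono mult_pos_pos) auto
        finally show "\<bar>(1/4 + real k) / ((1/4 + real k)\<^sup>2 + t\<^sup>2 / 4) - (1/4 + real k) / ((1/4 + real k)\<^sup>2)\<bar> \<le> t\<^sup>2 * c k"
          unfolding b_def[symmetric] q_def[symmetric] c_def by (simp add: power3_eq_cube power2_eq_square)
      qed
      finally show ?thesis .
    qed
    also have "\<dots> = t\<^sup>2 * (\<Sum>k<n. c k)" by (simp add: sum_distrib_left)
    also have "\<dots> \<le> t\<^sup>2 * D" by (intro mult_left_mono D) auto
    finally have "\<bar>psi_sum n t\<bar> \<le> K + t\<^sup>2 * D" using K(2)[of n] by linarith
    also have "\<dots> \<le> (K + D) * (1 + t\<^sup>2)"
      using K(1) \<open>D \<ge> 0\<close> by (simp add: algebra_simps)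
    finally show ?thesis .
  qed
  thus ?thesis using K(1) \<open>D \<ge> 0\<close> by (intro that[of "K + D"]) auto
qed


subsection \<open>The integral formula and the expansion of \<open>\<Phi>\<close>\<close>

lemma integrable_times_cos:
  fixes f :: "real \<Rightarrow> real"
  assumes "integrable lborel f"
  shows   "integrable lborel (\<lambda>t. f t * cos (t * w))"
  by (rule Bochner_Integration.integrable_bound[OF assms])
     (use assms in \<open>auto simp: abs_mult mult_left_le\<close>)

lemma integral_even_half:
  fixes f :: "real \<Rightarrow> real"
  assumes int: "integrable lborel f" and even: "\<And>t. f (- t) = f t"
  shows   "has_bochner_integral lborel (\<lambda>t. indicator {0<..} t * f t) (integral\<^sup>L lborel f / 2)"
proof -
  have i1: "integrable lborel (\<lambda>t. indicator {0<..} t * f t)"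
    using integrable_mult_indicator[OF _ int, of "{0<..}"] by simp
  have i2: "integrable lborel (\<lambda>t. indicator {..<0} t * f t)"
    using integrable_mult_indicator[OF _ int, of "{..<0}"] by simp
  have "integral\<^sup>L lborel f = (LINT t|lborel. indicator {0<..} t * f t + indicator {..<0} t * f t)"
  proof (rule integral_cong_AE)
    show "AE t in lborel. f t = indicator {0<..} t * f t + indicator {..<0} t * f t"
      using AE_lborel_singleton[of 0] by eventually_elim (auto simp: indicator_def)
  qed (use int in auto)
  also have "\<dots> = (LINT t|lborel. indicator {0<..} t * f t) + (LINT t|lborel. indicator {..<0} t * f t)"
    by (rule Bochner_Integration.integral_add[OF i1 i2])
  also have "(LINT t|lborel. indicator {..<0} t * f t) = (LINT t|lborel. indicator {0<..} t * f t)"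
    by (subst lborel_integral_real_affine[of "-1" _ 0])
       (auto intro!: Bochner_Integration.integral_cong simp: even indicator_def)
  finally show ?thesis using i1 by (simp add: has_bochner_integral_iff)
qed

text \<open>This is the real part of the characteristic function of the standard normal law at
  w/sqrt(2x), rescaled and halved by evenness. The case w = 0 also serves as the plain Gaussian
  integral.\<close>

lemma has_bochner_integral_gauss_cos:
  assumes x: "x > 0"
  shows "has_bochner_integral lborel (\<lambda>t. indicator {0<..} t * (exp (- x * t\<^sup>2) * cos (t * w)))
           (sqrt (pi / x) / 2 * exp (- w\<^sup>2 / (4 * x)))"
proof -
  define c where "c = sqrt (2 * x)"
  have c: "c > 0" "c\<^sup>2 = 2 * x" using x by (simp_all add: c_def)
  define r where "r = w / c"
  have int: "integrable lborel std_normal_density" by simp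
  have "char std_normal_distribution r = of_real (exp (- r\<^sup>2 / 2))"
    by (simp add: char_std_normal_distribution)
  also have "char std_normal_distribution r = (CLINT y|lborel. std_normal_density y *\<^sub>R iexp (r * y))"
    unfolding char_def by (subst integral_density) auto
  finally have "Re (CLINT y|lborel. std_normal_density y *\<^sub>R iexp (r * y)) = exp (- r\<^sup>2 / 2)" by simp
  also have "Re (CLINT y|lborel. std_normal_density y *\<^sub>R iexp (r * y)) =
      (LINT y|lborel. Re (std_normal_density y *\<^sub>R iexp (r * y)))"
  proof (rule integral_Re[symmetric])
    show "complex_integrable lborel (\<lambda>y. std_normal_density y *\<^sub>R iexp (r * y))"
      by (rule Bochner_Integration.integrable_bound[OF int]) auto
  qed
  also have "\<dots> = (LINT y|lborel. std_normal_density y * cos (r * y))"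
    by (simp add: Re_exp)
  also have "\<dots> = c * (LINT t|lborel. std_normal_density (c * t) * cos (w * t))"
    using c by (subst lborel_integral_real_affine[of c _ 0]) (simp_all add: r_def)
  also have "\<dots> = c * (LINT t|lborel. (1 / sqrt (2 * pi)) * (exp (- x * t\<^sup>2) * cos (t * w)))"
    by (simp add: std_normal_density_def power_mult_distrib c mult_ac)
  also have "\<dots> = (c / sqrt (2 * pi)) * (LINT t|lborel. exp (- x * t\<^sup>2) * cos (t * w))"
    by (subst integral_mult_right_zero) simp
  finally have "(LINT t|lborel. exp (- x * t\<^sup>2) * cos (t * w)) = (sqrt (2 * pi) / c) * exp (- r\<^sup>2 / 2)"
    using c by (simp add: field_simps)
  also have "sqrt (2 * pi) / c = sqrt (pi / x)" using x by (simp add: c_def flip: real_sqrt_divide)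
  also have "- r\<^sup>2 / 2 = - w\<^sup>2 / (4 * x)" by (simp add: r_def power_divide c)
  finally have val: "(LINT t|lborel. exp (- x * t\<^sup>2) * cos (t * w)) = sqrt (pi / x) * exp (- w\<^sup>2 / (4 * x))" .
  have "integrable lborel (\<lambda>t. sqrt (2 * pi) * std_normal_density (0 + c * t))"
    using c by (intro integrable_mult_right lborel_integrable_real_affine int) auto
  also have "(\<lambda>t. sqrt (2 * pi) * std_normal_density (0 + c * t)) = (\<lambda>t. exp (- x * t\<^sup>2))"
    by (simp add: std_normal_density_def power_mult_distrib c)
  finally have "integrable lborel (\<lambda>t. exp (- x * t\<^sup>2) * cos (t * w))"
    by (rule integrable_times_cos)
  from integral_even_half[OF this] val show ?thesis by simp
qed

text \<open>The value is Re 1/(b + iv), the shape of the summands of \<open>psi_sum\<close>. The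
  explicit antiderivative \<open>G\<close> vanishes at infinity, so only its value at 0
  remains.\<close>

lemma has_bochner_integral_exp_cos:
  fixes b v :: real
  assumes b: "b > 0"
  shows "has_bochner_integral lborel (\<lambda>u. indicator {0<..} u * (exp (- b * u) * cos (u * v))) (b / (b\<^sup>2 + v\<^sup>2))"
proof -
  have q: "b\<^sup>2 + v\<^sup>2 > 0" using b by (intro add_pos_nonneg) auto
  have "integrable lborel (\<lambda>u. indicator {0<..} u * (u powr (1 - 1) * exp (- b * u powr 1)) :: real)"
    using has_bochner_integral_powr_exp[of 1 1 b] b by (auto simp: has_bochner_integral_iff)
  also have "(\<lambda>u. indicator {0<..} u * (u powr (1 - 1) * exp (- b * u powr 1)) :: real) = (\<lambda>u. indicator {0<..} u * exp (- b * u))"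
    by (rule ext) (auto simp: indicator_def)
  finally have "integrable lborel (\<lambda>u. indicator {0<..} u * exp (- b * u) * cos (u * v))"
    by (rule integrable_times_cos)
  hence int: "integrable lborel (\<lambda>u. indicator {0<..} u * (exp (- b * u) * cos (u * v)))"
    by (simp add: mult.assoc)
  define G where "G u = exp (- b * u) * (v * sin (u * v) - b * cos (u * v)) / (b\<^sup>2 + v\<^sup>2)" for u
  have "(LBINT u=0..\<infinity>. exp (- b * u) * cos (u * v)) = 0 - G 0"
  proof (rule interval_integral_FTC_integrable)
    fix u :: real
    have "((\<lambda>u. exp (- b * u) * (v * sin (u * v) - b * cos (u * v))) has_real_derivative
             (b\<^sup>2 + v\<^sup>2) * (exp (- b * u) * cos (u * v))) (at u)"
      by (auto intro!: derivative_eq_intros simp: algebra_simps power2_eq_square)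
    from DERIV_cdivide[OF this, of "b\<^sup>2 + v\<^sup>2"]
    show "(G has_vector_derivative exp (- b * u) * cos (u * v)) (at u)"
      unfolding G_def has_real_derivative_iff_has_vector_derivative[symmetric] using b by simp
    show "isCont (\<lambda>u. exp (- b * u) * cos (u * v)) u" by (intro continuous_intros)
  next
    show "set_integrable lborel (einterval 0 \<infinity>) (\<lambda>u. exp (- b * u) * cos (u * v))"
      using int by (simp add: set_integrable_def zero_ereal_def)
    have "isCont G 0" unfolding G_def using q by (intro continuous_intros) auto
    hence "(G \<longlongrightarrow> G 0) (at_right 0)"
      by (simp add: isCont_def filterlim_at_split)
    thus "((G \<circ> real_of_ereal) \<longlongrightarrow> G 0) (at_right 0)"
      unfolding zero_ereal_def by (simp only: ereal_tendsto_simps1)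
    have "((\<lambda>u. (\<bar>v\<bar> + b) / (b\<^sup>2 + v\<^sup>2) * exp (- b * u)) \<longlongrightarrow> 0) at_top"
      using b by real_asymp
    moreover have "norm (G u) \<le> (\<bar>v\<bar> + b) / (b\<^sup>2 + v\<^sup>2) * exp (- b * u)" for u
    proof -
      have "\<bar>v * sin (u * v) - b * cos (u * v)\<bar> \<le> \<bar>v * sin (u * v)\<bar> + \<bar>b * cos (u * v)\<bar>" by linarith
      also have "\<dots> \<le> \<bar>v\<bar> + b"
        using b by (intro add_mono) (auto simp: abs_mult mult_left_le)
      finally show ?thesis using q by (simp add: G_def abs_mult divide_right_mono mult_left_mono mult.commute)
    qed
    ultimately have "(G \<longlongrightarrow> 0) at_top"
      by (rule_tac Lim_null_comparison) auto
    thus "((G \<circ> real_of_ereal) \<longlongrightarrow> 0) (at_left \<infinity>)"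
      by (simp add: ereal_tendsto_simps1)
  qed auto
  hence "(LINT u|lborel. indicator {0<..} u * (exp (- b * u) * cos (u * v))) = - G 0"
    by (simp add: zero_ereal_def interval_integral_to_infinity_eq set_lebesgue_integral_def)
  with int show ?thesis by (simp add: has_bochner_integral_iff G_def)
qed

lemma integrable_lborel_prod_times:
  fixes f g :: "real \<Rightarrow> real"
  assumes f: "integrable lborel f" and g: "integrable lborel g"
  shows "integrable (lborel \<Otimes>\<^sub>M lborel) (\<lambda>(x,y). f x * g y)"
proof (rule lborel_pair.Fubini_integrable)
  show "(\<lambda>(x,y). f x * g y) \<in> borel_measurable (lborel \<Otimes>\<^sub>M lborel)"
    using borel_measurable_integrable[OF f] borel_measurable_integrable[OF g] by measurable
  show "integrable lborel (\<lambda>x. LINT y|lborel. norm (case (x, y) of (x, y) \<Rightarrow> f x * g y))"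
    using f by (simp add: abs_mult)
  show "AE x in lborel. integrable lborel (\<lambda>y. case (x, y) of (x, y) \<Rightarrow> f x * g y)"
    using g by simp
qed

lemma integrable_gauss:
  assumes "x > 0"
  shows "integrable lborel (\<lambda>t. indicator {0<..} t * exp (- x * t\<^sup>2) :: real)"
  using has_bochner_integral_gauss_cos[OF assms, of 0] by (simp add: has_bochner_integral_iff)

text \<open>Fubini for exp(-x t^2) exp(-b u) cos(tu/2): integration over u gives the Lorentzian,
  integration over t gives a Gaussian in u with exponent (u/2)^2/(4x), hence the 16.\<close>

lemma has_bochner_integral_gauss_lorentz:
  assumes x: "x > 0" and b: "b > 0"
  shows "has_bochner_integral lborel (\<lambda>t. indicator {0<..} t * (exp (- x * t\<^sup>2) * (b / (b\<^sup>2 + t\<^sup>2 / 4))))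
           (sqrt (pi / x) / 2 * (LINT u|lborel. indicator {0<..} u * (exp (- (1 / (16 * x)) * u\<^sup>2) * exp (- b * u))))"
proof -
  define g where "g t = (indicator {0<..} t * exp (- x * t\<^sup>2) :: real)" for t
  define h where "h u = (indicator {0<..} u * exp (- b * u) :: real)" for u
  have g: "integrable lborel g" unfolding g_def by (rule integrable_gauss[OF x])
  have h: "integrable lborel h"
    using has_bochner_integral_exp_cos[OF b, of 0] unfolding h_def by (simp add: has_bochner_integral_iff)
  have gh: "integrable (lborel \<Otimes>\<^sub>M lborel) (\<lambda>(t,u). g t * h u * cos (t * u / 2))"
  proof (rule Bochner_Integration.integrable_bound[OF integrable_lborel_prod_times[OF g h]])
    show "(\<lambda>(t,u). g t * h u * cos (t * u / 2)) \<in> borel_measurable (lborel \<Otimes>\<^sub>M lborel)"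
      unfolding g_def h_def by measurable
    show "AE p in lborel \<Otimes>\<^sub>M lborel. norm (case p of (t, u) \<Rightarrow> g t * h u * cos (t * u / 2)) \<le> norm (case p of (t, u) \<Rightarrow> g t * h u)"
      by (intro AE_I2) (auto simp: abs_mult mult_left_le)
  qed
  have inner_u: "(LINT u|lborel. g t * h u * cos (t * u / 2)) = indicator {0<..} t * (exp (- x * t\<^sup>2) * (b / (b\<^sup>2 + t\<^sup>2 / 4)))" for t
  proof -
    have "(LINT u|lborel. g t * h u * cos (t * u / 2)) = (LINT u|lborel. g t * (indicator {0<..} u * (exp (- b * u) * cos (u * (t / 2)))))"
      by (simp add: h_def mult_ac)
    also have "\<dots> = g t * (b / (b\<^sup>2 + (t / 2)\<^sup>2))"
      using has_bochner_integral_exp_cos[OF b, of "t / 2"] by (simp add: has_bochner_integral_iff)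
    finally show ?thesis by (simp add: g_def power_divide)
  qed
  have inner_t: "(LINT t|lborel. g t * h u * cos (t * u / 2)) = sqrt (pi / x) / 2 * (indicator {0<..} u * (exp (- (1 / (16 * x)) * u\<^sup>2) * exp (- b * u)))" for u
  proof -
    have "(LINT t|lborel. g t * h u * cos (t * u / 2)) = (LINT t|lborel. h u * (indicator {0<..} t * (exp (- x * t\<^sup>2) * cos (t * (u / 2)))))"
      by (simp add: g_def mult_ac)
    also have "\<dots> = h u * (sqrt (pi / x) / 2 * exp (- (u / 2)\<^sup>2 / (4 * x)))"
      using has_bochner_integral_gauss_cos[OF x, of "u / 2"] by (simp add: has_bochner_integral_iff)
    finally show ?thesis by (simp add: h_def power_divide mult_ac)
  qed
  have "integrable lborel (\<lambda>t. LINT u|lborel. g t * h u * cos (t * u / 2))"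
    using lborel_pair.integrable_fst'[OF gh] by simp
  moreover have "(LINT t|lborel. LINT u|lborel. g t * h u * cos (t * u / 2)) = (LINT u|lborel. LINT t|lborel. g t * h u * cos (t * u / 2))"
    using lborel_pair.Fubini_integral[OF gh] by simp
  ultimately show ?thesis
    unfolding inner_u inner_t by (simp add: has_bochner_integral_iff)
qed


section \<open>Gaussian integrals of the partial sums and their limit\<close>

lemma Psi_measurable [measurable]: "Psi \<in> borel_measurable borel"
proof (rule borel_measurable_LIMSEQ_metric)
  show "psi_sum n \<in> borel_measurable borel" for n
    unfolding psi_sum_def [abs_def] by measurable
qed (rule psi_sum_LIMSEQ)

lemma Phi_measurable [measurable]: "Phi \<in> borel_measurable borel"
  unfolding Phi_def [abs_def] set_lebesgue_integral_def
  by (intro borel_measurable_times borel_measurable_const lborel.borel_measurable_lebesgue_integral) measurable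

lemma digamma_kernel_measurable [measurable]: "digamma_kernel \<in> borel_measurable borel"
  unfolding digamma_kernel_def [abs_def] by measurable

lemma digamma_kernel_rem_measurable [measurable]: "digamma_kernel_rem N \<in> borel_measurable borel"
  unfolding digamma_kernel_rem_def [abs_def] by measurable

lemma sum_exp_eq_digamma_kernel:
  assumes u: "u > 0"
  shows "(\<Sum>k<n. exp (- (1/4 + real k) * u)) = (digamma_kernel u + 1 / u) * (1 - exp (- real n * u))"
proof -
  have "(\<Sum>k<n. exp (- (1/4 + real k) * u)) = exp (- u / 4) * (\<Sum>k<n. exp (- u) ^ k)"
    by (simp add: sum_distrib_left algebra_simps flip: exp_of_nat_mult exp_add)
  also have "(\<Sum>k<n. exp (- u) ^ k) = (1 - exp (- u) ^ n) / (1 - exp (- u))"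
    using u by (subst sum_gp_strict) auto
  also have "exp (- u) ^ n = exp (- real n * u)" by (simp flip: exp_of_nat_mult)
  finally show ?thesis by (simp add: digamma_kernel_def)
qed

lemma integrable_gauss_bounded:
  fixes f :: "real \<Rightarrow> real"
  assumes \<alpha>: "\<alpha> > 0" and [measurable]: "f \<in> borel_measurable borel"
    and bd: "\<And>u. u > 0 \<Longrightarrow> \<bar>f u\<bar> \<le> C * u ^ n"
  shows "integrable lborel (\<lambda>u. indicator {0<..} u * (exp (- \<alpha> * u\<^sup>2) * f u))"
    and "\<bar>LINT u|lborel. indicator {0<..} u * (exp (- \<alpha> * u\<^sup>2) * f u)\<bar> \<le>
           C * (Gamma (real (n + 1) / 2) * \<alpha> powr (- real (n + 1) / 2) / 2)"
proof -
  note I = has_bochner_integral_power_exp_square[OF \<alpha>, of n]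
  have J: "has_bochner_integral lborel (\<lambda>u. C * (indicator {0<..} u * (u ^ n * exp (- \<alpha> * u\<^sup>2))))
             (C * (Gamma (real (n + 1) / 2) * \<alpha> powr (- real (n + 1) / 2) / 2))"
    by (rule has_bochner_integral_mult_right[OF I])
  have bd': "\<bar>indicator {0<..} u * (exp (- \<alpha> * u\<^sup>2) * f u)\<bar> \<le> C * (indicator {0<..} u * (u ^ n * exp (- \<alpha> * u\<^sup>2)))" for u
    using mult_left_mono[OF bd[of u], of "exp (- \<alpha> * u\<^sup>2)"] by (auto simp: indicator_def abs_mult mult_ac)
  show *: "integrable lborel (\<lambda>u. indicator {0<..} u * (exp (- \<alpha> * u\<^sup>2) * f u))"
  proof (rule Bochner_Integration.integrable_bound)
    show "integrable lborel (\<lambda>u. C * (indicator {0<..} u * (u ^ n * exp (- \<alpha> * u\<^sup>2))))"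
      using J by (simp only: has_bochner_integral_iff)
  qed (use bd' in \<open>auto intro!: AE_I2 order.trans[OF _ abs_ge_self]\<close>)
  have "\<bar>LINT u|lborel. indicator {0<..} u * (exp (- \<alpha> * u\<^sup>2) * f u)\<bar> \<le>
         (LINT u|lborel. \<bar>indicator {0<..} u * (exp (- \<alpha> * u\<^sup>2) * f u)\<bar>)"
    by (rule integral_abs_bound)
  also have "\<dots> \<le> (LINT u|lborel. C * (indicator {0<..} u * (u ^ n * exp (- \<alpha> * u\<^sup>2))))"
    using J * bd' by (intro integral_mono integrable_abs) (auto simp only: has_bochner_integral_iff)
  also have "\<dots> = C * (Gamma (real (n + 1) / 2) * \<alpha> powr (- real (n + 1) / 2) / 2)"
    using J by (simp only: has_bochner_integral_iff)
  finally show "\<bar>LINT u|lborel. indicator {0<..} u * (exp (- \<alpha> * u\<^sup>2) * f u)\<bar> \<le> \<dots>" .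
qed

lemma digamma_kernel_rem_0: "digamma_kernel_rem 0 = digamma_kernel"
  by (rule ext) (simp add: digamma_kernel_rem_def)

lemma integrable_gauss_digamma_kernel_rem:
  "\<alpha> > 0 \<Longrightarrow> integrable lborel (\<lambda>u. indicator {0<..} u * (exp (- \<alpha> * u\<^sup>2) * digamma_kernel_rem N u))"
  using digamma_kernel_rem_bound[of N] integrable_gauss_bounded(1)[OF _ digamma_kernel_rem_measurable] by metis

lemma dominated_times_exp_LIMSEQ:
  fixes f :: "real \<Rightarrow> real"
  assumes f: "integrable lborel (\<lambda>u. indicator {0<..} u * f u)"
  shows "(\<lambda>n. LINT u|lborel. indicator {0<..} u * f u * exp (- real n * u)) \<longlonglongrightarrow> 0"
    and "integrable lborel (\<lambda>u. indicator {0<..} u * f u * exp (- real n * u))"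
proof -
  have bd: "norm (indicator {0<..} u * f u * exp (- real n * u)) \<le> norm (indicator {0<..} u * f u)" for n u
    by (auto simp: indicator_def abs_mult mult_left_le)
  note [measurable] = borel_measurable_integrable[OF f]
  have lim: "(\<lambda>n. indicator {0<..} u * f u * exp (- real n * u)) \<longlonglongrightarrow> 0" for u :: real
  proof (cases "u > 0")
    case True
    have "(\<lambda>n. exp (- real n * u)) \<longlonglongrightarrow> 0" using True by real_asymp
    hence "(\<lambda>n. indicator {0<..} u * f u * exp (- real n * u)) \<longlonglongrightarrow> indicator {0<..} u * f u * 0"
      by (intro tendsto_intros)
    thus ?thesis by simp
  qed auto
  have "(\<lambda>n. LINT u|lborel. indicator {0<..} u * f u * exp (- real n * u)) \<longlonglongrightarrow> integral\<^sup>L lborel (\<lambda>_::real. 0::real)"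
  proof (rule integral_dominated_convergence)
    show "integrable lborel (\<lambda>u. norm (indicator {0<..} u * f u))"
      by (rule integrable_norm[OF f])
    show "AE u in lborel. norm (indicator {0<..} u * f u * exp (- real n * u)) \<le> norm (indicator {0<..} u * f u)" for n
      by (rule AE_I2) (rule bd)
    show "AE u in lborel. (\<lambda>n. indicator {0<..} u * f u * exp (- real n * u)) \<longlonglongrightarrow> 0"
      by (rule AE_I2) (rule lim)
  qed measurable
  thus "(\<lambda>n. LINT u|lborel. indicator {0<..} u * f u * exp (- real n * u)) \<longlonglongrightarrow> 0" by simp
  show "integrable lborel (\<lambda>u. indicator {0<..} u * f u * exp (- real n * u))"
    by (rule Bochner_Integration.integrable_bound[OF f]) (use bd in \<open>auto intro!: AE_I2\<close>)
qed

text \<open>The geometric sum is (\<open>digamma_kernel u\<close> + 1/u)(1 - exp(-nu)). The Frullani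
  parameter n + 1 arises as 1 + n: the correction is the quotient for parameter 1 damped by
  exp(-nu), which stays integrable and tends to 0. The resulting ln(n + 1) is cancelled by ln n in
  the limit.\<close>

lemma exp_sum_integral_LIMSEQ:
  assumes \<alpha>: "\<alpha> > 0"
  shows "(\<lambda>n. (LINT u|lborel. indicator {0<..} u * (exp (- \<alpha> * u\<^sup>2) * (\<Sum>k<n. exp (- (1/4 + real k) * u)))) - ln (real n)) \<longlonglongrightarrow>
           (LINT u|lborel. indicator {0<..} u * (exp (- \<alpha> * u\<^sup>2) * digamma_kernel u)) - ln \<alpha> / 2 + euler_mascheroni / 2"
proof -
  define K where "K u = exp (- \<alpha> * u\<^sup>2) * digamma_kernel u" for u
  have K: "integrable lborel (\<lambda>u. indicator {0<..} u * K u)"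
    using integrable_gauss_digamma_kernel_rem[OF \<alpha>, of 0] by (simp add: digamma_kernel_rem_0 K_def)
  have F: "has_bochner_integral lborel (\<lambda>u. indicator {0<..} u * frullani_quot \<alpha> \<beta> u) (ln \<beta> - ln \<alpha> / 2 + euler_mascheroni / 2)" if "\<beta> > 0" for \<beta>
    by (rule has_bochner_integral_frullani_quot[OF \<alpha> that])
  have F1: "integrable lborel (\<lambda>u. indicator {0<..} u * frullani_quot \<alpha> 1 u)"
    using F[of 1] by (simp add: has_bochner_integral_iff)
  have eq: "(LINT u|lborel. indicator {0<..} u * (exp (- \<alpha> * u\<^sup>2) * (\<Sum>k<n. exp (- (1/4 + real k) * u)))) =
        (LINT u|lborel. indicator {0<..} u * K u) - (LINT u|lborel. indicator {0<..} u * K u * exp (- real n * u)) +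
        (ln (real n + 1) - ln \<alpha> / 2 + euler_mascheroni / 2) - (LINT u|lborel. indicator {0<..} u * frullani_quot \<alpha> 1 u * exp (- real n * u))" for n
  proof -
    txt \<open>The singular part \<open>exp(-\<alpha> u\<^sup>2) (1 - exp(-n u))/u\<close> splits into a Frullani integral and a
      term that vanishes as \<open>n \<rightarrow> \<infinity>\<close>.\<close>
    have "(\<lambda>u. indicator {0<..} u * (exp (- \<alpha> * u\<^sup>2) * (\<Sum>k<n. exp (- (1/4 + real k) * u)))) =
      (\<lambda>u. indicator {0<..} u * K u - indicator {0<..} u * K u * exp (- real n * u) +
         indicator {0<..} u * frullani_quot \<alpha> (real n + 1) u - indicator {0<..} u * frullani_quot \<alpha> 1 u * exp (- real n * u))"
    proof (rule ext)
      fix u :: real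
      show "indicator {0<..} u * (exp (- \<alpha> * u\<^sup>2) * (\<Sum>k<n. exp (- (1/4 + real k) * u))) =
        indicator {0<..} u * K u - indicator {0<..} u * K u * exp (- real n * u) +
         indicator {0<..} u * frullani_quot \<alpha> (real n + 1) u - indicator {0<..} u * frullani_quot \<alpha> 1 u * exp (- real n * u)"
      proof (cases "u > 0")
        case True
        have "exp (- (real n + 1) * u) = exp (- 1 * u) * exp (- real n * u)"
          by (simp add: algebra_simps flip: exp_add)
        hence "frullani_quot \<alpha> (real n + 1) u - frullani_quot \<alpha> 1 u * exp (- real n * u) = exp (- \<alpha> * u\<^sup>2) * ((1 / u) * (1 - exp (- real n * u)))"
          using True unfolding frullani_quot_def by (simp add: diff_divide_distrib algebra_simps)
        thus ?thesis
          unfolding sum_exp_eq_digamma_kernel[OF True] using True by (simp add: K_def algebra_simps)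
      qed auto
    qed
    moreover have "has_bochner_integral lborel \<dots> ((LINT u|lborel. indicator {0<..} u * K u) - (LINT u|lborel. indicator {0<..} u * K u * exp (- real n * u)) +
        (ln (real n + 1) - ln \<alpha> / 2 + euler_mascheroni / 2) - (LINT u|lborel. indicator {0<..} u * frullani_quot \<alpha> 1 u * exp (- real n * u)))"
      by (intro has_bochner_integral_diff has_bochner_integral_add F has_bochner_integral_integrable K F1 dominated_times_exp_LIMSEQ(2)) auto
    ultimately show ?thesis by (simp only: has_bochner_integral_iff)
  qed
  have "(\<lambda>n. ln (real n + 1) - ln (real n)) \<longlonglongrightarrow> 0" by real_asymp
  hence "(\<lambda>n. (LINT u|lborel. indicator {0<..} u * K u) - (LINT u|lborel. indicator {0<..} u * K u * exp (- real n * u)) +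
        ((ln (real n + 1) - ln (real n)) - ln \<alpha> / 2 + euler_mascheroni / 2) - (LINT u|lborel. indicator {0<..} u * frullani_quot \<alpha> 1 u * exp (- real n * u)))
     \<longlonglongrightarrow> (LINT u|lborel. indicator {0<..} u * K u) - 0 + (0 - ln \<alpha> / 2 + euler_mascheroni / 2) - 0"
    by (intro tendsto_intros dominated_times_exp_LIMSEQ(1) K F1)
  thus ?thesis unfolding eq by (simp add: K_def algebra_simps)
qed

text \<open>The partial sums are integrated exactly by
  \<open>has_bochner_integral_gauss_lorentz\<close>, and both sides then pass to the limit. As
  \<alpha> = 1/(16x), the constants 2 ln pi - ln \<alpha> combine to ln(16 pi^2 x).\<close>

lemma Phi_eq:
  assumes x: "x > 0"
  shows "Phi x = (euler_mascheroni + ln (16 * pi\<^sup>2 * x) +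
           2 * (LINT u|lborel. indicator {0<..} u * (exp (- (1 / (16 * x)) * u\<^sup>2) * digamma_kernel u))) / (8 * sqrt (pi * x))"
proof -
  define \<alpha> where "\<alpha> = 1 / (16 * x)"
  have \<alpha>: "\<alpha> > 0" using x by (simp add: \<alpha>_def)
  define J where "J = (LINT u|lborel. indicator {0<..} u * (exp (- \<alpha> * u\<^sup>2) * digamma_kernel u))"
  define g where "g t = (indicator {0<..} t * exp (- x * t\<^sup>2) :: real)" for t
  have g: "has_bochner_integral lborel g (sqrt (pi / x) / 2)"
    using has_bochner_integral_gauss_cos[OF x, of 0] by (simp add: g_def [abs_def])
  obtain C where C: "C \<ge> 0" "\<And>n t. \<bar>psi_sum n t\<bar> \<le> C * (1 + t\<^sup>2)"
    using psi_sum_bound by metis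
  \<comment> \<open>The majorant C (1 + t^2) exp(-x t^2) for all partial sums, split into two
    Gaussian moments.\<close>
  have w: "integrable lborel (\<lambda>t. C * (g t + indicator {0<..} t * (t ^ 2 * exp (- x * t\<^sup>2))))"
    using g has_bochner_integral_power_exp_square[OF x, of 2] unfolding has_bochner_integral_iff
    by (intro integrable_mult_right Bochner_Integration.integrable_add) auto
  have [measurable]: "g \<in> borel_measurable borel" "psi_sum n \<in> borel_measurable borel" for n
    unfolding g_def psi_sum_def [abs_def] by measurable
  have lim1: "(\<lambda>n. LINT t|lborel. g t * psi_sum n t) \<longlonglongrightarrow> (LINT t|lborel. g t * Psi t)"
  proof (rule integral_dominated_convergence[OF _ _ w])
    show "AE t in lborel. (\<lambda>n. g t * psi_sum n t) \<longlonglongrightarrow> g t * Psi t"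
      by (intro AE_I2 tendsto_intros psi_sum_LIMSEQ)
    show "AE t in lborel. norm (g t * psi_sum n t) \<le> C * (g t + indicator {0<..} t * (t ^ 2 * exp (- x * t\<^sup>2)))" for n
    proof (intro AE_I2)
      fix t :: real
      have "norm (g t * psi_sum n t) \<le> g t * (C * (1 + t\<^sup>2))"
        using C(2)[of n t] by (simp add: abs_mult g_def mult_left_mono)
      thus "norm (g t * psi_sum n t) \<le> C * (g t + indicator {0<..} t * (t ^ 2 * exp (- x * t\<^sup>2)))"
        by (simp add: g_def algebra_simps)
    qed
  qed auto
  have val: "(LINT t|lborel. g t * psi_sum n t) = sqrt (pi / x) / 2 * (ln pi +
      ((LINT u|lborel. indicator {0<..} u * (exp (- \<alpha> * u\<^sup>2) * (\<Sum>k<n. exp (- (1/4 + real k) * u)))) - ln (real n)))" for n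
  proof -
    define E where "E k u = (indicator {0<..} u * (exp (- \<alpha> * u\<^sup>2) * exp (- (1/4 + real k) * u)) :: real)" for k u
    have E: "integrable lborel (E k)" for k
      unfolding E_def by (rule integrable_gauss_bounded(1)[OF \<alpha>, where C = 1 and n = 0])
        (auto intro!: mult_nonpos_nonneg)
    have "has_bochner_integral lborel (\<lambda>t. (ln pi - ln (real n)) * g t + (\<Sum>k<n. indicator {0<..} t * (exp (- x * t\<^sup>2) * ((1/4 + real k) / ((1/4 + real k)\<^sup>2 + t\<^sup>2 / 4)))))
       ((ln pi - ln (real n)) * (sqrt (pi / x) / 2) + (\<Sum>k<n. sqrt (pi / x) / 2 * integral\<^sup>L lborel (E k)))"
      unfolding E_def \<alpha>_def
      by (intro has_bochner_integral_add has_bochner_integral_mult_right g has_bochner_integral_sum has_bochner_integral_gauss_lorentz x) auto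
    also have "(\<lambda>t. (ln pi - ln (real n)) * g t + (\<Sum>k<n. indicator {0<..} t * (exp (- x * t\<^sup>2) * ((1/4 + real k) / ((1/4 + real k)\<^sup>2 + t\<^sup>2 / 4))))) = (\<lambda>t. g t * psi_sum n t)"
      by (rule ext) (simp add: psi_sum_def g_def sum_distrib_left algebra_simps)
    finally have "(LINT t|lborel. g t * psi_sum n t) = (ln pi - ln (real n)) * (sqrt (pi / x) / 2) + (\<Sum>k<n. sqrt (pi / x) / 2 * integral\<^sup>L lborel (E k))"
      by (simp only: has_bochner_integral_iff)
    also have "(\<Sum>k<n. sqrt (pi / x) / 2 * integral\<^sup>L lborel (E k)) = sqrt (pi / x) / 2 * (LINT u|lborel. (\<Sum>k<n. E k u))"
      by (subst Bochner_Integration.integral_sum) (auto intro: E simp: sum_distrib_left)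
    also have "(\<lambda>u. \<Sum>k<n. E k u) = (\<lambda>u. indicator {0<..} u * (exp (- \<alpha> * u\<^sup>2) * (\<Sum>k<n. exp (- (1/4 + real k) * u))))"
      by (rule ext) (simp add: E_def sum_distrib_left)
    finally show ?thesis by (simp only: algebra_simps)
  qed
  have "(\<lambda>n. LINT t|lborel. g t * psi_sum n t) \<longlonglongrightarrow> sqrt (pi / x) / 2 * (ln pi + (J - ln \<alpha> / 2 + euler_mascheroni / 2))"
    unfolding val J_def by (intro tendsto_intros exp_sum_integral_LIMSEQ \<alpha>)
  with lim1 have "(LINT t|lborel. g t * Psi t) = sqrt (pi / x) / 2 * (ln pi + (J - ln \<alpha> / 2 + euler_mascheroni / 2))"
    by (rule LIMSEQ_unique)
  moreover have "Phi x = 1 / (2 * pi) * (LINT t|lborel. g t * Psi t)"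
    by (simp add: Phi_def set_lebesgue_integral_def g_def mult_ac)
  ultimately have "Phi x = (sqrt (pi / x) / (8 * pi)) * (2 * ln pi + (2 * J - ln \<alpha> + euler_mascheroni))"
    by (simp add: field_simps)
  also have "2 * ln pi + (2 * J - ln \<alpha> + euler_mascheroni) = euler_mascheroni + ln (16 * pi\<^sup>2 * x) + 2 * J"
    using x by (simp add: \<alpha>_def ln_div ln_mult ln_realpow)
  also have "sqrt (pi / x) / (8 * pi) = 1 / (8 * sqrt (pi * x))"
  proof -
    have "sqrt (pi / x) * sqrt (pi * x) = pi"
      using x by (simp add: real_sqrt_mult real_sqrt_divide)
    thus ?thesis using x by (simp add: field_simps)
  qed
  finally show ?thesis by (simp add: J_def \<alpha>_def)
qed

text \<open>Obtained from \<open>Phi_eq\<close> by replacing the kernel with its Taylor polynomial: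
  the moment of u^(n-1) against exp(-u^2/(16x)) is (4 sqrt x)^n Gamma(n/2)/2, and the 1/2 cancels
  the factor in front of the integral.\<close>

definition Phi_main :: "nat \<Rightarrow> real \<Rightarrow> real" where
  "Phi_main N x = (euler_mascheroni + ln (16 * pi\<^sup>2 * x) +
     (\<Sum>n=1..N. bernpoly n (3/4) / fact n * ((4 * sqrt x) ^ n * Gamma (real n / 2)))) / (8 * sqrt (pi * x))"

definition Phi_rem :: "nat \<Rightarrow> real \<Rightarrow> real" where
  "Phi_rem N x = Phi x - Phi_main N x"

lemma Phi_rem_measurable [measurable]: "Phi_rem N \<in> borel_measurable borel"
  unfolding Phi_rem_def [abs_def] Phi_main_def by measurable

text \<open>Integrating the kernel bound u^N against the Gaussian gives a multiple of x^((N+1)/2);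
  the factor 1/sqrt x of \<open>Phi_eq\<close> lowers the exponent to N/2.\<close>

lemma Phi_rem_bound:
  obtains C where "C \<ge> 0" "\<And>x. x > 0 \<Longrightarrow> \<bar>Phi_rem N x\<bar> \<le> C * x powr (real N / 2)"
proof -
  obtain C where C: "C \<ge> 0" "\<And>u. u > 0 \<Longrightarrow> \<bar>digamma_kernel_rem N u\<bar> \<le> C * u ^ N"
    using digamma_kernel_rem_bound[of N] by metis
  define D where "D = C * Gamma (real (N + 1) / 2) * 16 powr (real (N + 1) / 2) / (8 * sqrt pi)"
  have "\<bar>Phi_rem N x\<bar> \<le> D * x powr (real N / 2)" if x: "x > 0" for x
  proof -
    define \<alpha> where "\<alpha> = 1 / (16 * x)"
    have \<alpha>: "\<alpha> > 0" using x by (simp add: \<alpha>_def)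
    have ap: "\<alpha> powr (- y / 2) = (16 * x) powr (y / 2)" for y
      using x by (simp add: \<alpha>_def powr_divide powr_minus)
    have apow: "\<alpha> powr (- real n / 2) = (4 * sqrt x) ^ n" for n
    proof -
      have "\<alpha> powr (- real n / 2) = (16 * x) powr (real n / 2)" by (rule ap)
      also have "\<dots> = ((16 * x) powr (1 / 2)) powr real n" by (simp add: powr_powr)
      also have "(16 * x) powr (1 / 2) = 4 * sqrt x"
        using x by (simp add: powr_half_sqrt real_sqrt_mult)
      also have "(4 * sqrt x) powr real n = (4 * sqrt x) ^ n"
        using x by (intro powr_realpow) auto
      finally show ?thesis .
    qed
    define b where "b n = bernpoly n (3/4) / fact n" for n
    define R where "R = (LINT u|lborel. indicator {0<..} u * (exp (- \<alpha> * u\<^sup>2) * digamma_kernel_rem N u))"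
    have split: "(\<lambda>u. indicator {0<..} u * (exp (- \<alpha> * u\<^sup>2) * digamma_kernel u)) =
       (\<lambda>u. (\<Sum>n=1..N. b n * (indicator {0<..} u * (u ^ (n - 1) * exp (- \<alpha> * u\<^sup>2)))) +
            indicator {0<..} u * (exp (- \<alpha> * u\<^sup>2) * digamma_kernel_rem N u))"
      by (rule ext) (simp add: digamma_kernel_rem_def b_def sum_distrib_left algebra_simps)
    have "has_bochner_integral lborel (\<lambda>u. indicator {0<..} u * (exp (- \<alpha> * u\<^sup>2) * digamma_kernel u))
       ((\<Sum>n=1..N. b n * (Gamma (real ((n - 1) + 1) / 2) * \<alpha> powr (- real ((n - 1) + 1) / 2) / 2)) + R)"
      unfolding split R_def
      by (intro has_bochner_integral_add has_bochner_integral_sum has_bochner_integral_mult_right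
            has_bochner_integral_power_exp_square has_bochner_integral_integrable integrable_gauss_digamma_kernel_rem \<alpha>)
    hence "(LINT u|lborel. indicator {0<..} u * (exp (- \<alpha> * u\<^sup>2) * digamma_kernel u)) =
         (\<Sum>n=1..N. b n * (Gamma (real ((n - 1) + 1) / 2) * \<alpha> powr (- real ((n - 1) + 1) / 2) / 2)) + R"
      by (simp only: has_bochner_integral_iff)
    also have "(\<Sum>n=1..N. b n * (Gamma (real ((n - 1) + 1) / 2) * \<alpha> powr (- real ((n - 1) + 1) / 2) / 2)) =
         (\<Sum>n=1..N. b n * ((4 * sqrt x) ^ n * Gamma (real n / 2)) / 2)"
    proof (intro sum.cong refl)
      fix n assume "n \<in> {1..N}"
      hence "n - 1 + 1 = n" by auto
      thus "b n * (Gamma (real ((n - 1) + 1) / 2) * \<alpha> powr (- real ((n - 1) + 1) / 2) / 2) = b n * ((4 * sqrt x) ^ n * Gamma (real n / 2)) / 2"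
        by (simp only: apow) simp
    qed
    finally have J: "2 * (LINT u|lborel. indicator {0<..} u * (exp (- \<alpha> * u\<^sup>2) * digamma_kernel u)) =
        (\<Sum>n=1..N. b n * ((4 * sqrt x) ^ n * Gamma (real n / 2))) + 2 * R"
      by (simp add: sum_divide_distrib[symmetric])
    have "Phi_rem N x = 2 * R / (8 * sqrt (pi * x))"
      unfolding Phi_rem_def Phi_main_def Phi_eq[OF x] \<alpha>_def[symmetric] J b_def[symmetric]
      by (simp add: diff_divide_distrib add_divide_distrib)
    hence "\<bar>Phi_rem N x\<bar> = 2 * \<bar>R\<bar> / (8 * sqrt (pi * x))" using x by (simp add: abs_mult)
    also have "\<dots> \<le> 2 * (C * (Gamma (real (N + 1) / 2) * \<alpha> powr (- real (N + 1) / 2) / 2)) / (8 * sqrt (pi * x))"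
      unfolding R_def using x
      by (intro divide_right_mono mult_left_mono integrable_gauss_bounded(2)[OF \<alpha> digamma_kernel_rem_measurable C(2)]) auto
    also have "\<alpha> powr (- real (N + 1) / 2) = 16 powr (real (N + 1) / 2) * (x powr (real N / 2) * sqrt x)"
    proof -
      have "\<alpha> powr (- real (N + 1) / 2) = (16 * x) powr (real (N + 1) / 2)"
        by (rule ap)
      also have "\<dots> = 16 powr (real (N + 1) / 2) * x powr (real N / 2 + 1 / 2)"
        using x by (simp add: powr_mult add_divide_distrib add.commute)
      also have "x powr (real N / 2 + 1 / 2) = x powr (real N / 2) * sqrt x"
        using x by (simp add: powr_add powr_half_sqrt)
      finally show ?thesis .
    qed
    also have "2 * (C * (Gamma (real (N + 1) / 2) * (16 powr (real (N + 1) / 2) * (x powr (real N / 2) * sqrt x)) / 2)) / (8 * sqrt (pi * x)) = D * x powr (real N / 2)"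
      using x by (simp add: D_def real_sqrt_mult field_simps)
    finally show ?thesis .
  qed
  moreover have "D \<ge> 0" using C(1) by (simp add: D_def Gamma_real_nonneg)
  ultimately show ?thesis using that by blast
qed


subsection \<open>Truncated Mellin transforms\<close>

lemma has_bochner_integral_powr_from_0:
  fixes a q :: real
  assumes a: "a > 0" and q: "q > 0"
  shows "has_bochner_integral lborel (\<lambda>x. indicator {0<..<a} x * x powr (q - 1)) (a powr q / q)"
proof -
  have I: "((\<lambda>x. x powr (q - 1)) has_integral a powr q / q) {0..a}"
    using has_integral_powr_from_0[of "q - 1" a] a q by simp
  have "has_bochner_integral lborel (\<lambda>x. indicator {0..a} x * x powr (q - 1)) (a powr q / q)"
    by (rule has_bochner_integral_nn_integral)
       (use nn_integral_has_integral_lebesgue[OF _ I] q in auto)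
  moreover have "AE x in lborel. indicator {0..a} x * x powr (q - 1) = indicator {0<..<a} x * x powr (q - 1)"
    using AE_lborel_singleton[of 0] AE_lborel_singleton[of a] by eventually_elim (auto simp: indicator_def)
  ultimately show ?thesis
    by (subst has_bochner_integral_cong_AE[symmetric]) auto
qed

lemma exp_abs_ln_le:
  fixes x d :: real
  assumes "x > 0" "d \<ge> 0"
  shows "exp (d * \<bar>ln x\<bar>) \<le> x powr d + x powr (- d)"
  using assms by (auto simp: abs_if powr_def)

text \<open>A logarithm costs only an arbitrarily small power of x, at 0 and at infinity.\<close>

lemma abs_ln_le_powr:
  fixes x d :: real
  assumes x: "x > 0" and d: "d > 0"
  shows "\<bar>ln x\<bar> \<le> exp (d * \<bar>ln x\<bar>) / d" "\<bar>ln x\<bar> \<le> (x powr d + x powr (- d)) / d"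
proof -
  have "d * \<bar>ln x\<bar> \<le> exp (d * \<bar>ln x\<bar>)" using exp_ge_add_one_self[of "d * \<bar>ln x\<bar>"] by linarith
  thus *: "\<bar>ln x\<bar> \<le> exp (d * \<bar>ln x\<bar>) / d" using d by (simp add: field_simps)
  also have "\<dots> \<le> (x powr d + x powr (- d)) / d"
    using exp_abs_ln_le[OF x, of d] d by (intro divide_right_mono) auto
  finally show "\<bar>ln x\<bar> \<le> (x powr d + x powr (- d)) / d" .
qed

definition mellin_fun :: "(real \<Rightarrow> real) \<Rightarrow> real \<Rightarrow> complex \<Rightarrow> real \<Rightarrow> complex" where
  "mellin_fun f a s x = indicat_real {0<..<a} x *\<^sub>R (of_real (f x) * of_real x powr (s / 2) / of_real x)"

lemma mellin_fun_measurable [measurable]: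
  assumes [measurable]: "f \<in> borel_measurable borel"
  shows "mellin_fun f a s \<in> borel_measurable borel"
proof -
  have "mellin_fun f a s = (\<lambda>x. indicat_real {0<..<a} x *\<^sub>R (of_real (f x) * exp (s / 2 * of_real (ln x)) / of_real x))"
    by (rule ext) (auto simp: mellin_fun_def indicator_def powr_def Ln_of_real)
  thus ?thesis by simp
qed

lemma norm_mellin_fun:
  "norm (mellin_fun f a s x) = indicator {0<..<a} x * (\<bar>f x\<bar> * x powr (Re s / 2 - 1))"
  by (auto simp: mellin_fun_def indicator_def norm_mult norm_divide norm_powr_real_powr powr_diff)

definition mellin :: "(real \<Rightarrow> real) \<Rightarrow> real \<Rightarrow> complex \<Rightarrow> complex" where
  "mellin f a s = (LINT x|lborel. mellin_fun f a s x)"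

lemma mellin_altdef:
  "mellin f a s = (LINT x:{0<..<a}|lborel. of_real (f x) * of_real x powr (s / 2) / of_real x)"
  by (simp add: mellin_def mellin_fun_def set_lebesgue_integral_def)

context
  fixes f :: "real \<Rightarrow> real" and a C p :: real
  assumes meas [measurable]: "f \<in> borel_measurable borel"
    and a: "a > 0" and C: "C \<ge> 0"
    and bound: "\<And>x. 0 < x \<Longrightarrow> x < a \<Longrightarrow> \<bar>f x\<bar> \<le> C * x powr p"
begin

lemma norm_mellin_fun_le:
  "norm (mellin_fun f a s x) \<le> C * (indicator {0<..<a} x * x powr (p + Re s / 2 - 1))"
proof (cases "x \<in> {0<..<a}")
  case True
  hence "\<bar>f x\<bar> * x powr (Re s / 2 - 1) \<le> C * x powr p * x powr (Re s / 2 - 1)"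
    using bound[of x] by (intro mult_right_mono) auto
  also have "\<dots> = C * x powr (p + Re s / 2 - 1)"
    by (simp add: mult.assoc add_diff_eq flip: powr_add)
  finally show ?thesis using True by (simp add: norm_mellin_fun)
qed (auto simp: norm_mellin_fun)

lemma mellin_fun_integrable:
  assumes s: "p + Re s / 2 > 0"
  shows "integrable lborel (mellin_fun f a s)"
proof (rule Bochner_Integration.integrable_bound)
  show "integrable lborel (\<lambda>x. C * (indicator {0<..<a} x * x powr (p + Re s / 2 - 1)))"
    using has_bochner_integral_powr_from_0[OF a s] by (simp add: has_bochner_integral_iff)
  show "AE x in lborel. norm (mellin_fun f a s x) \<le> norm (C * (indicator {0<..<a} x * x powr (p + Re s / 2 - 1)))"
    using norm_mellin_fun_le by (auto intro!: AE_I2 order.trans[OF _ abs_ge_self])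
qed auto

lemma norm_mellin_le:
  assumes s: "p + Re s / 2 > 0"
  shows "norm (mellin f a s) \<le> C * (a powr (p + Re s / 2) / (p + Re s / 2))"
proof -
  have "norm (mellin f a s) \<le> (LINT x|lborel. norm (mellin_fun f a s x))"
    unfolding mellin_def by (rule integral_norm_bound)
  also have "\<dots> \<le> (LINT x|lborel. C * (indicator {0<..<a} x * x powr (p + Re s / 2 - 1)))"
    using has_bochner_integral_powr_from_0[OF a s] mellin_fun_integrable[OF s] norm_mellin_fun_le
    by (intro integral_mono integrable_norm) (auto simp: has_bochner_integral_iff)
  also have "\<dots> = C * (a powr (p + Re s / 2) / (p + Re s / 2))"
    using has_bochner_integral_powr_from_0[OF a s] by (simp add: has_bochner_integral_iff)
  finally show ?thesis .
qed

text \<open>Differentiation under the integral sign, by dominated convergence of the difference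
  quotients along arbitrary null sequences in a small ball.\<close>

lemma mellin_has_field_derivative:
  assumes s: "p + Re s / 2 > 0"
  shows "(mellin f a has_field_derivative (LINT x|lborel. mellin_fun f a s x * of_real (ln x / 2))) (at s)"
proof -
  \<comment> \<open>Half of the available exponent \<open>q\<close>: the majorant involves the
    exponents q + d and q - d = d, both positive.\<close>
  define d where "d = (p + Re s / 2) / 2"
  have d: "d > 0" using s by (simp add: d_def)
  define q where "q = p + Re s / 2"
  define w where "w x = C / d * (indicator {0<..<a} x * x powr (q + d - 1) + indicator {0<..<a} x * x powr (q - d - 1))" for x
  have w: "integrable lborel w"
  proof -
    have "q > 0" "d = q / 2" using s by (simp_all add: q_def d_def)
    hence "q + d > 0" "q - d > 0" by simp_all
    from this[THEN has_bochner_integral_powr_from_0[OF a]] show ?thesis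
      unfolding w_def has_bochner_integral_iff by (intro integrable_mult_right Bochner_Integration.integrable_add) blast+
  qed
  have "((\<lambda>h. (mellin f a (s + h) - mellin f a s) / h) \<longlongrightarrow> (LINT x|lborel. mellin_fun f a s x * of_real (ln x / 2))) (at 0 within ball 0 d)"
    unfolding tendsto_at_iff_sequentially
  proof (intro allI impI)
    fix h :: "nat \<Rightarrow> complex"
    assume h: "\<forall>i. h i \<in> ball 0 d - {0}" and h0: "h \<longlonglongrightarrow> 0"
    define Q where "Q i x = (mellin_fun f a (s + h i) x - mellin_fun f a s x) / h i" for i x
    have Q: "Q i x = mellin_fun f a s x * ((exp (h i * of_real (ln x / 2)) - 1) / h i)" for i x
    proof (cases "x \<in> {0<..<a}")
      case True
      hence "of_real x powr ((s + h i) / 2) = of_real x powr (s / 2) * exp (h i * of_real (ln x / 2))"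
        by (simp add: powr_def Ln_of_real add_divide_distrib ring_distribs exp_add)
      thus ?thesis using True h by (simp add: Q_def mellin_fun_def field_simps)
    qed (auto simp: Q_def mellin_fun_def)
    have "(\<lambda>i. LINT x|lborel. Q i x) \<longlonglongrightarrow> (LINT x|lborel. mellin_fun f a s x * of_real (ln x / 2))"
    proof (rule integral_dominated_convergence[OF _ _ w])
      show "AE x in lborel. (\<lambda>i. Q i x) \<longlonglongrightarrow> mellin_fun f a s x * of_real (ln x / 2)"
      proof (rule AE_I2)
        fix x :: real
        have "((\<lambda>y. exp (y * of_real (ln x / 2))) has_field_derivative of_real (ln x / 2)) (at (0::complex))"
          by (auto intro!: derivative_eq_intros)
        hence "((\<lambda>y. (exp (y * of_real (ln x / 2)) - 1) / y) \<longlongrightarrow> of_real (ln x / 2)) (at (0::complex))"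
          by (simp add: DERIV_def)
        moreover have "filterlim h (at 0) sequentially"
          using h h0 by (auto simp: filterlim_at)
        ultimately have "(\<lambda>i. (exp (h i * of_real (ln x / 2)) - 1) / h i) \<longlonglongrightarrow> of_real (ln x / 2)"
          by (rule filterlim_compose)
        thus "(\<lambda>i. Q i x) \<longlonglongrightarrow> mellin_fun f a s x * of_real (ln x / 2)"
          unfolding Q by (intro tendsto_intros)
      qed
      show "AE x in lborel. norm (Q i x) \<le> w x" for i
      proof (rule AE_I2)
        fix x :: real
        show "norm (Q i x) \<le> w x"
        proof (cases "x \<in> {0<..<a}")
          case True
          define l where "l = \<bar>ln x\<bar>"
          define z where "z = h i * of_real (ln x / 2)"
          have nz: "norm z = norm (h i) * (l / 2)" by (simp add: z_def norm_mult l_def)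
          have hi: "norm (h i) \<le> d" "h i \<noteq> 0" using h[rule_format, of i] by auto
          have "\<bar>Re z\<bar> \<le> norm z" by (rule abs_Re_le_cmod)
          also have "\<dots> \<le> d * (l / 2)" unfolding nz using hi by (intro mult_right_mono) (auto simp: l_def)
          finally have Rez: "\<bar>Re z\<bar> \<le> d / 2 * l" by simp
          \<comment> \<open>The budget \<open>d\<close> is shared equally: exp(d/2 * l) bounds the
            exponential, and a second such factor absorbs the logarithm that comes from dividing
            \<open>z\<close> by \<open>h i\<close>.\<close>
          have "norm (exp z - 1) \<le> exp \<bar>Re z\<bar> * norm z"
            using Taylor_exp[of z 0] by simp
          also have "\<dots> \<le> exp (d / 2 * l) * (norm (h i) * (l / 2))"
            unfolding nz using Rez by (intro mult_mono) (auto simp: l_def)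
          finally have "norm ((exp z - 1) / h i) \<le> exp (d / 2 * l) * (l / 2)"
            using hi by (simp add: norm_divide divide_le_eq mult_ac)
          also have "\<dots> \<le> exp (d / 2 * l) * (exp (d / 2 * l) / (d / 2) / 2)"
            using abs_ln_le_powr(1)[of x "d / 2"] True d by (intro mult_left_mono divide_right_mono) (auto simp: l_def)
          also have "\<dots> = exp (d * l) / d" using d by (simp flip: exp_add)
          also have "\<dots> \<le> (x powr d + x powr (- d)) / d"
            using exp_abs_ln_le[of x d] True d by (intro divide_right_mono) (auto simp: l_def)
          finally have e: "norm ((exp z - 1) / h i) \<le> (x powr d + x powr (- d)) / d" .
          have "norm (Q i x) \<le> (C * x powr (q - 1)) * ((x powr d + x powr (- d)) / d)"
            unfolding Q norm_mult z_def[symmetric] using norm_mellin_fun_le[of s x] True C e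
            by (intro mult_mono) (auto simp: q_def)
          also have "\<dots> = C / d * (x powr (q - 1) * x powr d + x powr (q - 1) * x powr (- d))"
            by (simp add: field_simps)
          also have "\<dots> = w x" using True by (simp add: w_def algebra_simps flip: powr_add)
          finally show ?thesis .
        qed (auto simp: Q mellin_fun_def w_def)
      qed
    qed (auto simp: Q_def)
    moreover have "(LINT x|lborel. Q i x) = (mellin f a (s + h i) - mellin f a s) / h i" for i
    proof -
      have "\<bar>Re (h i)\<bar> < d" using h[rule_format, of i] abs_Re_le_cmod[of "h i"] by auto
      hence "p + Re (s + h i) / 2 > 0" using s by (simp add: d_def field_simps)
      thus ?thesis unfolding Q_def mellin_def
        using mellin_fun_integrable[OF s] mellin_fun_integrable[of "s + h i"] by simp
    qed
    ultimately show "((\<lambda>h. (mellin f a (s + h) - mellin f a s) / h) \<circ> h) \<longlonglongrightarrow> (LINT x|lborel. mellin_fun f a s x * of_real (ln x / 2))"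
      by (simp add: o_def)
  qed
  thus ?thesis
    using d by (simp add: DERIV_def at_within_open[of 0 "ball 0 d"])
qed

lemma mellin_holomorphic: "mellin f a holomorphic_on {s. p + Re s / 2 > 0}"
  unfolding holomorphic_on_def field_differentiable_def
  using mellin_has_field_derivative by (auto intro: has_field_derivative_at_within)

end

section \<open>Truncated Mellin transforms of powers, with and without a logarithm\<close>

lemma of_real_powr_has_vector_derivative:
  fixes z :: complex and x :: real
  assumes "x > 0"
  shows "((\<lambda>x. of_real x powr z) has_vector_derivative (z * (of_real x powr z / of_real x))) (at x)"
proof -
  have "((\<lambda>w. w powr z) has_field_derivative (z * of_real x powr (z - 1))) (at (of_real x))"
    using assms by (intro has_field_derivative_powr) auto
  from field_vector_diff_chain_at[OF has_vector_derivative_of_real[OF DERIV_ident] this]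
  show ?thesis using assms by (simp add: o_def powr_diff)
qed

text \<open>The second value is the derivative of the first with respect to z. Its term 1/z^2 is the
  origin of the double pole at s = 1.\<close>

lemma has_bochner_integral_powr_complex:
  fixes a :: real and z :: complex
  assumes a: "a > 0" and z: "Re z > 0"
  shows "has_bochner_integral lborel (\<lambda>x. indicat_real {0<..<a} x *\<^sub>R (of_real x powr z / of_real x)) (of_real a powr z / z)"
    and "has_bochner_integral lborel (\<lambda>x. indicat_real {0<..<a} x *\<^sub>R (of_real (ln x) * of_real x powr z / of_real x))
          (of_real a powr z * (of_real (ln a) / z - 1 / z\<^sup>2))"
proof -
  have z0: "z \<noteq> 0" using z by auto
  have int1: "integrable lborel (\<lambda>x. indicat_real {0<..<a} x *\<^sub>R (of_real x powr z / of_real x))"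
    using mellin_fun_integrable[of "\<lambda>_. 1" a 1 0 "2 * z"] a z by (simp add: mellin_fun_def [abs_def])
  have int2: "integrable lborel (\<lambda>x. indicat_real {0<..<a} x *\<^sub>R (of_real (ln x) * of_real x powr z / of_real x))"
  proof -
    \<comment> \<open>Half of the decay at 0 is spent on the logarithm. On (0, a) the growing power
      is absorbed through x^d \<le> a^(2d) x^(-d), so a single negative power bounds |ln x|.\<close>
    define d where "d = Re z / 2"
    have d: "d > 0" using z by (simp add: d_def)
    have "integrable lborel (mellin_fun ln a (2 * z))"
    proof (rule mellin_fun_integrable[where C = "(a powr (2 * d) + 1) / d" and p = "- d"])
      fix x assume x: "0 < x" "x < a"
      have "x powr d = x powr (2 * d) * x powr (- d)" by (simp flip: powr_add)
      also have "\<dots> \<le> a powr (2 * d) * x powr (- d)"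
        using x d by (intro mult_right_mono powr_mono2) auto
      finally have "(x powr d + x powr (- d)) / d \<le> (a powr (2 * d) * x powr (- d) + x powr (- d)) / d"
        using d by (intro divide_right_mono) auto
      with abs_ln_le_powr(2)[OF x(1) d] show "\<bar>ln x\<bar> \<le> (a powr (2 * d) + 1) / d * x powr (- d)"
        by (simp add: algebra_simps add_divide_distrib)
    qed (use a d in \<open>auto simp: d_def add_nonneg_nonneg\<close>)
    thus ?thesis by (simp add: mellin_fun_def [abs_def])
  qed
  have ein: "einterval (ereal 0) (ereal a) = {0<..<a}" by simp
  have lim_a: "((F \<circ> real_of_ereal) \<longlongrightarrow> F a) (at_left (ereal a))" if "isCont F a" for F :: "real \<Rightarrow> complex"
    using that by (simp add: ereal_tendsto_simps1 isCont_def filterlim_at_split)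
  have contp: "isCont (\<lambda>x. of_real x powr z) x" if "x > 0" for x :: real
    using of_real_powr_has_vector_derivative[OF that] has_vector_derivative_continuous by blast
  have "(LBINT x=ereal 0..ereal a. of_real x powr z / of_real x) = of_real a powr z / z - 0"
  proof (rule interval_integral_FTC_integrable)
    show "ereal 0 < ereal a" using a by simp
    show "set_integrable lborel (einterval (ereal 0) (ereal a)) (\<lambda>x. of_real x powr z / of_real x)"
      using int1 unfolding ein set_integrable_def .
    fix x assume "ereal 0 < ereal x" hence x: "x > 0" by simp
    show "((\<lambda>x. of_real x powr z / z) has_vector_derivative of_real x powr z / of_real x) (at x)"
      using has_vector_derivative_divide[OF of_real_powr_has_vector_derivative[OF x, of z], of z] z0 by simp
    show "isCont (\<lambda>x. of_real x powr z / complex_of_real x) x"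
      using x contp[OF x] by (intro continuous_intros) auto
  next
    show "(((\<lambda>x. of_real x powr z / z) \<circ> real_of_ereal) \<longlongrightarrow> of_real a powr z / z) (at_left (ereal a))"
      using a z0 by (intro lim_a continuous_intros contp) auto
    have "((\<lambda>x. x powr r / c) \<longlongrightarrow> 0) (at_right 0)" if "r > 0" "c > 0" for r c :: real
      using that by real_asymp
    from this[of "Re z" "norm z"] have "((\<lambda>x. x powr Re z / norm z) \<longlongrightarrow> 0) (at_right 0)"
      using z z0 by simp
    hence "((\<lambda>x. of_real x powr z / z) \<longlongrightarrow> 0) (at_right 0)"
      by (rule Lim_null_comparison[rotated])
         (auto simp: eventually_at_right_field norm_divide norm_powr_real_powr intro!: exI[of _ 1])
    thus "(((\<lambda>x. of_real x powr z / z) \<circ> real_of_ereal) \<longlongrightarrow> 0) (at_right (ereal 0))"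
      by (simp only: ereal_tendsto_simps1)
  qed
  with int1 a show "has_bochner_integral lborel (\<lambda>x. indicat_real {0<..<a} x *\<^sub>R (of_real x powr z / of_real x)) (of_real a powr z / z)"
    by (simp add: has_bochner_integral_iff interval_lebesgue_integral_def set_lebesgue_integral_def)
  have "(LBINT x=ereal 0..ereal a. of_real (ln x) * of_real x powr z / of_real x) = of_real a powr z * (of_real (ln a) / z - 1 / z\<^sup>2) - 0"
  proof (rule interval_integral_FTC_integrable)
    show "ereal 0 < ereal a" using a by simp
    show "set_integrable lborel (einterval (ereal 0) (ereal a)) (\<lambda>x. of_real (ln x) * of_real x powr z / of_real x)"
      using int2 unfolding ein set_integrable_def .
    fix x assume "ereal 0 < ereal x" hence x: "x > 0" by simp
    have ln: "((\<lambda>x. complex_of_real (ln x) / z - 1 / z\<^sup>2) has_vector_derivative of_real (1 / x) / z - 0) (at x)"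
      using x by (intro has_vector_derivative_diff has_vector_derivative_divide has_vector_derivative_of_real has_vector_derivative_const)
                 (auto simp: has_real_derivative_iff_has_vector_derivative[symmetric] intro!: derivative_eq_intros)
    have "((\<lambda>x. of_real x powr z * (of_real (ln x) / z - 1 / z\<^sup>2)) has_vector_derivative
         of_real x powr z * (of_real (1 / x) / z - 0) + z * (of_real x powr z / of_real x) * (of_real (ln x) / z - 1 / z\<^sup>2)) (at x)"
      by (intro has_vector_derivative_mult of_real_powr_has_vector_derivative x ln)
    also have "of_real x powr z * (of_real (1 / x) / z - 0) + z * (of_real x powr z / of_real x) * (of_real (ln x) / z - 1 / z\<^sup>2) = of_real (ln x) * of_real x powr z / of_real x"
      using z0 x by (simp add: field_simps power2_eq_square)
    finally show "((\<lambda>x. of_real x powr z * (of_real (ln x) / z - 1 / z\<^sup>2)) has_vector_derivative of_real (ln x) * of_real x powr z / of_real x) (at x)" .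
    show "isCont (\<lambda>x. of_real (ln x) * of_real x powr z / complex_of_real x) x"
      using x contp[OF x] by (intro continuous_intros) auto
  next
    show "(((\<lambda>x. of_real x powr z * (of_real (ln x) / z - 1 / z\<^sup>2)) \<circ> real_of_ereal) \<longlongrightarrow> of_real a powr z * (of_real (ln a) / z - 1 / z\<^sup>2)) (at_left (ereal a))"
      using a z0 by (intro lim_a continuous_intros contp) auto
    have "((\<lambda>x. x powr r * (\<bar>ln x\<bar> / c + 1 / c ^ 2)) \<longlongrightarrow> 0) (at_right 0)" if "r > 0" "c > 0" for r c :: real
      using that by real_asymp
    from this[of "Re z" "norm z"] have "((\<lambda>x. x powr Re z * (\<bar>ln x\<bar> / norm z + 1 / norm z ^ 2)) \<longlongrightarrow> 0) (at_right 0)"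
      using z z0 by simp
    hence "((\<lambda>x. of_real x powr z * (of_real (ln x) / z - 1 / z\<^sup>2)) \<longlongrightarrow> 0) (at_right 0)"
    proof (rule Lim_null_comparison[rotated])
      have "norm (of_real x powr z * (of_real (ln x) / z - 1 / z\<^sup>2)) \<le> x powr Re z * (\<bar>ln x\<bar> / norm z + 1 / norm z ^ 2)" if "x > 0" for x
      proof -
        have "norm (of_real (ln x) / z - 1 / z\<^sup>2) \<le> norm (of_real (ln x) / z) + norm (1 / z\<^sup>2)" by (rule norm_triangle_ineq4)
        hence "norm (of_real (ln x) / z - 1 / z\<^sup>2) \<le> \<bar>ln x\<bar> / norm z + 1 / norm z ^ 2" by (simp add: norm_divide norm_power)
        thus ?thesis using that by (simp add: norm_mult norm_powr_real_powr mult_left_mono)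
      qed
      thus "\<forall>\<^sub>F x in at_right 0. norm (of_real x powr z * (of_real (ln x) / z - 1 / z\<^sup>2)) \<le> x powr Re z * (\<bar>ln x\<bar> / norm z + 1 / norm z ^ 2)"
        by (auto simp: eventually_at_right_field intro!: exI[of _ 1])
    qed
    thus "(((\<lambda>x. of_real x powr z * (of_real (ln x) / z - 1 / z\<^sup>2)) \<circ> real_of_ereal) \<longlongrightarrow> 0) (at_right (ereal 0))"
      by (simp only: ereal_tendsto_simps1)
  qed
  with int2 a show "has_bochner_integral lborel (\<lambda>x. indicat_real {0<..<a} x *\<^sub>R (of_real (ln x) * of_real x powr z / of_real x))
          (of_real a powr z * (of_real (ln a) / z - 1 / z\<^sup>2))"
    by (simp add: has_bochner_integral_iff interval_lebesgue_integral_def set_lebesgue_integral_def)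
qed


subsection \<open>Meromorphic continuation\<close>

lemma of_real_powr_times_sqrt_power:
  fixes w :: complex and x :: real
  assumes "x > 0"
  shows "of_real x powr w * of_real (sqrt x ^ n) = of_real x powr (w + of_nat n / 2)"
proof -
  have "sqrt x ^ n = (x powr (1 / 2)) powr real n"
    using assms by (simp add: powr_half_sqrt powr_realpow)
  also have "\<dots> = x powr (real n / 2)"
    by (simp add: powr_powr)
  finally have "of_real (sqrt x ^ n) = of_real x powr (of_nat n / 2 :: complex)"
    using assms powr_of_real[of x "real n / 2"] by simp
  thus ?thesis using assms by (simp add: powr_add)
qed

definition prefactor :: "real \<Rightarrow> complex \<Rightarrow> complex" where
  "prefactor a s = of_real a powr ((s - 1) / 2) / of_real (4 * sqrt pi)"

definition lead_term :: "real \<Rightarrow> complex \<Rightarrow> complex" where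
  "lead_term a s = - 2 / (s - 1)^2 + of_real (euler_mascheroni + ln (16 * pi^2 * a)) / (s - 1)"

definition bern_coeff :: "nat \<Rightarrow> real \<Rightarrow> complex" where
  "bern_coeff n a = of_real (bernpoly n (3/4) / fact n) * of_real ((4 * sqrt a)^n * Gamma (real n / 2))"

text \<open>Holds at every s: at its poles \<open>Gamma\<close> has the value 0, and 1/0 = 0 is the
  true value of the entire function \<open>rGamma\<close> there.\<close>

lemma S_main_altdef:
  "S_main N a s = prefactor a s * (rGamma (s / 2) * lead_term a s +
     (\<Sum>n=1..N. bern_coeff n a * (rGamma (s / 2) / (s + of_nat n - 1))))"
proof -
  have sum_eq: "(\<Sum>n=1..N. bern_coeff n a * (rGamma (s / 2) / (s + of_nat n - 1))) = rGamma (s / 2) *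
     (\<Sum>n=1..N. of_real (bernpoly n (3/4) / fact n) * (of_real ((4 * sqrt a)^n * Gamma (real n / 2)) / (s + of_nat n - 1)))"
    by (simp add: sum_distrib_left bern_coeff_def mult_ac)
  have "p / (c * G) * (X + Y + T) = p / c * (inverse G * (X + Y) + inverse G * T)" for p c G X Y T :: complex
    by (simp add: divide_inverse algebra_simps)
  thus ?thesis
    unfolding S_main_def lead_term_def prefactor_def sum_eq unfolding rGamma_inverse_Gamma .
qed

lemma S_main_Suc:
  "S_main (Suc N) a s = S_main N a s + prefactor a s * (bern_coeff (Suc N) a * (rGamma (s / 2) / (s + of_nat N)))"
  by (simp add: S_main_altdef algebra_simps)

text \<open>For odd \<open>n\<close> the zero of \<open>1/\<Gamma>(s/2)\<close> at \<open>1 - n\<close> cancels the pole, which leaves the derivative.\<close>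

definition ext_term :: "nat \<Rightarrow> complex \<Rightarrow> complex" where
  "ext_term n s = (if s + of_nat n - 1 = 0 then deriv (\<lambda>w. rGamma (w / 2)) s else rGamma (s / 2) / (s + of_nat n - 1))"

lemma rGamma_half_differentiable: "(\<lambda>w. rGamma (w / 2)) field_differentiable (at (s :: complex))"
proof -
  have "(\<lambda>w. rGamma (w / 2)) holomorphic_on UNIV" by (intro holomorphic_intros) auto
  thus ?thesis by (simp add: holomorphic_on_def)
qed

lemma rGamma_half_tendsto: "((\<lambda>w. rGamma (w / 2)) \<longlongrightarrow> rGamma (s / 2)) (at (s :: complex))"
  using field_differentiable_imp_continuous_at[OF rGamma_half_differentiable] by (simp add: isCont_def)

lemma ext_term_tendsto:
  assumes "s + of_nat n - 1 = 0 \<Longrightarrow> odd n"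
  shows "((\<lambda>w. rGamma (w / 2) / (w + of_nat n - 1)) \<longlongrightarrow> ext_term n s) (at s)"
proof (cases "s + of_nat n - 1 = 0")
  case True
  then obtain j where j: "n = 2 * j + 1" using assms by (auto elim: oddE)
  have s: "s = - (2 * of_nat j)" using True j by (simp add: algebra_simps add_eq_0_iff2)
  have "rGamma (s / 2) = 0" by (simp add: s rGamma_eq_zero_iff)
  moreover have "((\<lambda>w. rGamma (w / 2)) has_field_derivative deriv (\<lambda>w. rGamma (w / 2)) s) (at s)"
    using rGamma_half_differentiable by (simp add: DERIV_deriv_iff_field_differentiable)
  ultimately have "((\<lambda>w. rGamma (w / 2) / (w - s)) \<longlongrightarrow> deriv (\<lambda>w. rGamma (w / 2)) s) (at s)"
    by (simp add: has_field_derivative_iff)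
  moreover have "w - s = w + of_nat n - 1" for w using True by (simp add: algebra_simps)
  ultimately show ?thesis using True by (simp add: ext_term_def)
next
  case False
  thus ?thesis
    unfolding ext_term_def by (auto intro!: tendsto_intros rGamma_half_tendsto)
qed

text \<open>The points -(2k - 1) are the points 1 - n with n = 2k, so outside \<open>S_poles\<close>
  only odd n can make a denominator vanish.\<close>

lemma not_in_S_poles:
  assumes "s \<notin> S_poles"
  shows "s \<noteq> 1" "n \<ge> 1 \<Longrightarrow> s + of_nat n - 1 = 0 \<Longrightarrow> odd n"
proof -
  show "s \<noteq> 1" using assms by (auto simp: S_poles_def)
  assume n: "n \<ge> 1" "s + of_nat n - 1 = 0"
  show "odd n"
  proof
    assume "even n"
    then obtain k where k: "n = 2 * k" by (auto elim: evenE)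
    hence "s = - (2 * of_nat k - 1)" "k \<ge> 1" using n by (auto simp: algebra_simps add_eq_0_iff2)
    thus False using assms by (auto simp: S_poles_def)
  qed
qed

text \<open>For a > 0 and s outside \<open>S_poles\<close> this is the limit of
  \<open>S_main N a\<close> at s, hence the value of
  \<open>remove_sings (S_main N a) s\<close>.\<close>

definition ext_main :: "nat \<Rightarrow> real \<Rightarrow> complex \<Rightarrow> complex" where
  "ext_main N a s = prefactor a s * (rGamma (s / 2) * lead_term a s + (\<Sum>n=1..N. bern_coeff n a * ext_term n s))"

lemma prefactor_tendsto: "a > 0 \<Longrightarrow> (prefactor a \<longlongrightarrow> prefactor a s) (at s)"
  unfolding prefactor_def [abs_def] by (intro tendsto_intros) auto

lemma S_main_tendsto:
  assumes "a > 0" "s \<noteq> 1" "\<And>n. n \<in> {1..N} \<Longrightarrow> s + of_nat n - 1 = 0 \<Longrightarrow> odd n"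
  shows "(S_main N a \<longlongrightarrow> ext_main N a s) (at s)"
  unfolding S_main_altdef [abs_def] ext_main_def lead_term_def using assms
  by (intro tendsto_intros prefactor_tendsto rGamma_half_tendsto ext_term_tendsto) auto

text \<open>The candidate for the continuation on Re s > -N. The Mellin transform is holomorphic
  there, so every singularity comes from \<open>S_main\<close>.\<close>

definition S_approx :: "nat \<Rightarrow> real \<Rightarrow> complex \<Rightarrow> complex" where
  "S_approx N a s = S_main N a s + rGamma (s / 2) * mellin (Phi_rem N) a s"

lemma Phi_rem_mellin:
  assumes a: "a > 0" and s: "Re s > - real N"
  shows "integrable lborel (mellin_fun (Phi_rem N) a s)"
    and "isCont (mellin (Phi_rem N) a) s"
    and "mellin (Phi_rem N) a analytic_on {s}"
proof -
  obtain C where C: "C \<ge> 0" "\<And>x. x > 0 \<Longrightarrow> \<bar>Phi_rem N x\<bar> \<le> C * x powr (real N / 2)"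
    using Phi_rem_bound[of N] by metis
  have s': "real N / 2 + Re s / 2 > 0" using s by simp
  show "integrable lborel (mellin_fun (Phi_rem N) a s)"
    by (rule mellin_fun_integrable[OF _ a C(1) _ s']) (auto intro: C(2))
  have hol: "mellin (Phi_rem N) a holomorphic_on {s. real N / 2 + Re s / 2 > 0}"
    by (rule mellin_holomorphic[OF _ a C(1)]) (auto intro: C(2))
  have op: "open {s. real N / 2 + Re s / 2 > 0}"
    by (intro open_Collect_less continuous_intros) auto
  show an: "mellin (Phi_rem N) a analytic_on {s}"
    using analytic_on_open[OF op] hol s' analytic_on_subset by blast
  thus "isCont (mellin (Phi_rem N) a) s"
    by (rule analytic_at_imp_isCont)
qed

text \<open>The two remainders differ by the monomial k x^(N/2), whose transform over (0, a) is k
  a^z/z with z = (s + N)/2. This is precisely the term that \<open>S_main\<close> gains. On Re s >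
  -N all integrals involved converge.\<close>

lemma S_approx_Suc:
  assumes a: "a > 0" and s: "Re s > - real N"
  shows "S_approx (Suc N) a s = S_approx N a s"
proof -
  define b where "b = bernpoly (Suc N) (3/4) / fact (Suc N)"
  define k where "k = b * 4 ^ Suc N * Gamma (real (Suc N) / 2) / (8 * sqrt pi)"
  define z where "z = (s + of_nat N) / 2"
  have z: "Re z > 0" using s by (simp add: z_def)
  hence zN: "s + of_nat N \<noteq> 0" by (auto simp: z_def complex_eq_iff)
  have "mellin_fun (Phi_rem N) a s = (\<lambda>x. mellin_fun (Phi_rem (Suc N)) a s x +
          of_real k * (indicat_real {0<..<a} x *\<^sub>R (of_real x powr z / of_real x)))"
  proof (rule ext)
    fix x :: real
    show "mellin_fun (Phi_rem N) a s x = mellin_fun (Phi_rem (Suc N)) a s x +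
          of_real k * (indicat_real {0<..<a} x *\<^sub>R (of_real x powr z / of_real x))"
    proof (cases "x \<in> {0<..<a}")
      case True
      hence x: "x > 0" by simp
      have "Phi_rem N x = Phi_rem (Suc N) x + b * ((4 * sqrt x) ^ Suc N * Gamma (real (Suc N) / 2)) / (8 * sqrt (pi * x))"
        by (simp add: Phi_rem_def Phi_main_def b_def add_divide_distrib)
      also have "b * ((4 * sqrt x) ^ Suc N * Gamma (real (Suc N) / 2)) / (8 * sqrt (pi * x)) = k * sqrt x ^ N"
        using x by (simp add: k_def power_mult_distrib real_sqrt_mult)
      finally have eq: "Phi_rem N x = Phi_rem (Suc N) x + k * sqrt x ^ N" .
      have p: "of_real x powr (s / 2) * of_real (sqrt x ^ N) = of_real x powr z"
        using of_real_powr_times_sqrt_power[OF x, of "s / 2" N] by (simp add: z_def add_divide_distrib)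
      show ?thesis
        using True unfolding mellin_fun_def eq p[symmetric] by (simp add: add_divide_distrib algebra_simps)
    qed (auto simp: mellin_fun_def)
  qed
  moreover have "has_bochner_integral lborel \<dots> (mellin (Phi_rem (Suc N)) a s + of_real k * (of_real a powr z / z))"
    unfolding mellin_def using s
    by (intro has_bochner_integral_add has_bochner_integral_mult_right has_bochner_integral_powr_complex a z
          has_bochner_integral_integrable Phi_rem_mellin(1)) auto
  ultimately have m: "mellin (Phi_rem N) a s = mellin (Phi_rem (Suc N)) a s + of_real k * (of_real a powr z / z)"
    unfolding mellin_def by (simp add: has_bochner_integral_iff)
  have "S_main (Suc N) a s = S_main N a s + prefactor a s * (bern_coeff (Suc N) a * (rGamma (s / 2) / (s + of_nat N)))"
    by (rule S_main_Suc)
  also have "prefactor a s * (bern_coeff (Suc N) a * (rGamma (s / 2) / (s + of_nat N))) = rGamma (s / 2) * (of_real k * (of_real a powr z / z))"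
  proof -
    have "(s - 1) / 2 + of_nat (Suc N) / 2 = z" by (simp add: z_def add_divide_distrib[symmetric])
    hence az: "of_real a powr z = of_real a powr ((s - 1) / 2) * of_real (sqrt a ^ Suc N)"
      using of_real_powr_times_sqrt_power[OF a, of "(s - 1) / 2" "Suc N"] by metis
    have k: "of_real k = (of_real (b * 4 ^ Suc N * Gamma (real (Suc N) / 2)) / (8 * of_real (sqrt pi)) :: complex)"
      by (simp add: k_def)
    have bc: "bern_coeff (Suc N) a = of_real (b * 4 ^ Suc N * Gamma (real (Suc N) / 2)) * of_real (sqrt a ^ Suc N)"
      by (simp add: bern_coeff_def b_def power_mult_distrib)
    have pf: "prefactor a s = of_real a powr ((s - 1) / 2) / (4 * of_real (sqrt pi))"
      by (simp add: prefactor_def)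
    \<comment> \<open>The denominator z is half of s + N, which turns 8 sqrt pi into the 4 sqrt pi
      of the prefactor.\<close>
    have "P / (4 * r) * (B * S * (g / D)) = g * (B / (8 * r) * (P * S / (D / 2)))"
      if "r \<noteq> 0" "D \<noteq> 0" for P r B S g D :: complex
      using that by (simp add: field_simps)
    thus ?thesis
      unfolding az k bc pf unfolding z_def using zN by simp
  qed
  finally show ?thesis
    unfolding S_approx_def m by (simp add: algebra_simps)
qed

text \<open>Without Bernoulli terms only (C_0 + ln(16 pi^2 x))/(8 sqrt(pi x)) is split off, and its
  transform is explicit in z = (s - 1)/2. The -1/z^2 = -4/(s - 1)^2 from the logarithm becomes the
  -2/(s - 1)^2 of the expansion after 8 sqrt pi is rewritten as twice 4 sqrt pi.\<close>

lemma S_approx_0: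
  assumes a: "a > 0" and s: "Re s > 1"
  shows "S_approx 0 a s = S_int a s"
proof -
  define \<kappa> where "\<kappa> = euler_mascheroni + ln (16 * pi\<^sup>2)"
  define z where "z = (s - 1) / 2"
  have z: "Re z > 0" using s by (simp add: z_def)
  have "mellin_fun Phi a s = (\<lambda>x. mellin_fun (Phi_rem 0) a s x +
          1 / of_real (8 * sqrt pi) * (of_real \<kappa> * (indicat_real {0<..<a} x *\<^sub>R (of_real x powr z / of_real x)) +
             indicat_real {0<..<a} x *\<^sub>R (of_real (ln x) * of_real x powr z / of_real x)))"
  proof (rule ext)
    fix x :: real
    show "mellin_fun Phi a s x = mellin_fun (Phi_rem 0) a s x +
          1 / of_real (8 * sqrt pi) * (of_real \<kappa> * (indicat_real {0<..<a} x *\<^sub>R (of_real x powr z / of_real x)) +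
             indicat_real {0<..<a} x *\<^sub>R (of_real (ln x) * of_real x powr z / of_real x))"
    proof (cases "x \<in> {0<..<a}")
      case True
      hence x: "x > 0" by simp
      have eq: "Phi x = Phi_rem 0 x + (\<kappa> + ln x) / (8 * sqrt pi * sqrt x)"
        using x by (simp add: Phi_rem_def Phi_main_def \<kappa>_def ln_mult real_sqrt_mult add.assoc mult.assoc)
      have p: "of_real x powr (s / 2) = of_real x powr z * of_real (sqrt x)"
        using of_real_powr_times_sqrt_power[OF x, of z 1] by (simp add: z_def diff_divide_distrib)
      have "of_real (Phi x) * of_real x powr (s / 2) = of_real (Phi_rem 0 x) * of_real x powr (s / 2) +
               1 / of_real (8 * sqrt pi) * ((of_real \<kappa> + of_real (ln x)) * of_real x powr z)"
        unfolding eq p using x by (simp add: field_simps)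
      thus ?thesis
        using True unfolding mellin_fun_def by (simp add: add_divide_distrib distrib_left distrib_right)
    qed (auto simp: mellin_fun_def)
  qed
  moreover have "has_bochner_integral lborel \<dots> (mellin (Phi_rem 0) a s +
      1 / of_real (8 * sqrt pi) * (of_real \<kappa> * (of_real a powr z / z) + of_real a powr z * (of_real (ln a) / z - 1 / z\<^sup>2)))"
    unfolding mellin_def using s
    by (intro has_bochner_integral_add has_bochner_integral_mult_right has_bochner_integral_powr_complex a z
          has_bochner_integral_integrable Phi_rem_mellin(1)) auto
  ultimately have m: "mellin Phi a s = mellin (Phi_rem 0) a s +
      1 / of_real (8 * sqrt pi) * (of_real \<kappa> * (of_real a powr z / z) + of_real a powr z * (of_real (ln a) / z - 1 / z\<^sup>2))"
    unfolding mellin_def by (simp add: has_bochner_integral_iff)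
  have "1 / of_real (8 * sqrt pi) * (of_real \<kappa> * (of_real a powr z / z) + of_real a powr z * (of_real (ln a) / z - 1 / z\<^sup>2)) = prefactor a s * lead_term a s"
  proof -
    have s1: "s - 1 = 2 * z" by (simp add: z_def)
    have z0: "z \<noteq> 0" using z by auto
    have "of_real (euler_mascheroni + ln (16 * pi\<^sup>2 * a)) = of_real \<kappa> + (of_real (ln a) :: complex)"
      using a by (simp add: \<kappa>_def ln_mult)
    thus ?thesis
      unfolding prefactor_def lead_term_def s1 using z0 by (simp add: field_simps power2_eq_square)
  qed
  with m have m': "mellin Phi a s = mellin (Phi_rem 0) a s + prefactor a s * lead_term a s" by simp
  have "S_int a s = rGamma (s / 2) * mellin Phi a s"
    by (simp add: S_int_def mellin_altdef rGamma_inverse_Gamma inverse_eq_divide)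
  thus ?thesis
    unfolding S_approx_def S_main_altdef m' by (simp add: distrib_left mult_ac)
qed

text \<open>
  On \<open>Re s > -N\<close> the value of \<open>S_approx N a s\<close> does not change when \<open>N\<close> grows, so any admissible \<open>N\<close> will do.
\<close>

definition S_raw :: "real \<Rightarrow> complex \<Rightarrow> complex" where
  "S_raw a s = S_approx (nat \<lceil>- Re s\<rceil> + 1) a s"

lemma S_raw_eq:
  assumes a: "a > 0" and s: "Re s > - real N"
  shows "S_raw a s = S_approx N a s"
proof -
  have mono: "S_approx (N + k) a s = S_approx N a s" if "Re s > - real N" for N k
    by (induction k) (use that in \<open>auto simp: S_approx_Suc[OF a]\<close>)
  define M where "M = nat \<lceil>- Re s\<rceil> + 1"
  have M: "Re s > - real M" unfolding M_def by linarith
  show ?thesis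
    unfolding S_raw_def M_def[symmetric] using mono[OF s, of "M - N"] mono[OF M, of "N - M"]
    by (cases "M \<le> N") auto
qed

lemma eventually_S_raw_eq:
  assumes a: "a > 0" and s: "Re s > - real N"
  shows "eventually (\<lambda>w. S_raw a w = S_approx N a w) (at s)"
proof -
  have "eventually (\<lambda>w. w \<in> {w. Re w > - real N}) (at s)"
    using s open_halfspace_Re_gt by (intro eventually_at_in_open') auto
  thus ?thesis by eventually_elim (auto intro: S_raw_eq[OF a])
qed

text \<open>Around any s the half-plane Re w > -N is an open neighbourhood on which
  \<open>S_raw\<close> is the single function \<open>S_approx N\<close>.\<close>

lemma S_raw_meromorphic:
  assumes a: "a > 0"
  shows "S_raw a meromorphic_on UNIV"
  unfolding meromorphic_on_meromorphic_at[of _ UNIV]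
proof
  fix s :: complex
  define N where "N = nat \<lceil>- Re s\<rceil> + 1"
  have s: "Re s > - real N" unfolding N_def by linarith
  have rG: "(\<lambda>w. rGamma (w / 2)) analytic_on {s}"
    by (intro analytic_on_holomorphic[THEN iffD2] exI[of _ UNIV]) (auto intro!: holomorphic_intros)
  have pf: "prefactor a analytic_on {s}"
    unfolding prefactor_def [abs_def] using a by (intro analytic_intros) auto
  have "S_approx N a meromorphic_on {s}"
    unfolding S_approx_def [abs_def] S_main_altdef lead_term_def
    by (intro meromorphic_intros analytic_on_imp_meromorphic_on[OF rG] analytic_on_imp_meromorphic_on[OF pf]
          analytic_on_imp_meromorphic_on[OF Phi_rem_mellin(3)[OF a s]])
  thus "S_raw a meromorphic_on {s}"
    using meromorphic_on_cong[of "{s}" "S_raw a" "S_approx N a" "{s}"] eventually_S_raw_eq[OF a s] by simp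
qed

text \<open>A finite limit excludes a pole and is also the value assigned by
  \<open>remove_sings\<close>, so this one statement feeds the comparison with \<open>S_int\<close>,
  the pole set and the asymptotics.\<close>

lemma S_raw_tendsto:
  assumes a: "a > 0" and N: "Re s > - real N" and s: "s \<notin> S_poles"
  shows "(S_raw a \<longlongrightarrow> ext_main N a s + rGamma (s / 2) * mellin (Phi_rem N) a s) (at s)"
proof -
  have "(S_main N a \<longlongrightarrow> ext_main N a s) (at s)"
    using not_in_S_poles[OF s] by (intro S_main_tendsto a) auto
  moreover have "(mellin (Phi_rem N) a \<longlongrightarrow> mellin (Phi_rem N) a s) (at s)"
    using Phi_rem_mellin(2)[OF a N] by (simp add: isCont_def)
  ultimately have "(S_approx N a \<longlongrightarrow> ext_main N a s + rGamma (s / 2) * mellin (Phi_rem N) a s) (at s)"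
    unfolding S_approx_def [abs_def] by (intro tendsto_intros rGamma_half_tendsto)
  thus ?thesis
    using filterlim_cong[OF refl refl eventually_S_raw_eq[OF a N]] by blast
qed

lemma is_pole_S_raw:
  assumes a: "a > 0" and s: "s \<in> S_poles"
  shows "is_pole (S_raw a) s"
proof -
  have pf0: "prefactor a w \<noteq> 0" for w using a by (simp add: prefactor_def)
  from s consider "s = 1" | k where "k \<ge> 1" "s = - (2 * of_nat k - 1)"
    by (auto simp: S_poles_def)
  thus ?thesis
  proof cases
    case 1
    have N: "Re s > - real 0" by (simp add: 1)
    define c where "c = complex_of_real (euler_mascheroni + ln (16 * pi^2 * a))"
    \<comment> \<open>Both leading terms over the common denominator (w - 1)^2; the numerator at 1
      is nonzero thanks to the -2.\<close>
    define f where "f w = prefactor a w * rGamma (w / 2) * (- 2 + c * (w - 1))" for w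
    have ft: "(f \<longlongrightarrow> f s) (at s)"
      unfolding f_def [abs_def] by (intro tendsto_intros prefactor_tendsto rGamma_half_tendsto a)
    have "rGamma (1 / 2 :: complex) \<noteq> 0"
      by (subst rGamma_eq_zero_iff) (auto elim!: nonpos_Ints_cases simp: complex_eq_iff)
    hence "f s \<noteq> 0" using pf0[of s] by (simp add: f_def 1)
    moreover have "filterlim (\<lambda>w. (w - 1) ^ 2) (at 0) (at s)"
      unfolding 1 by (auto simp: filterlim_at eventually_at_filter intro!: tendsto_eq_intros)
    ultimately have "is_pole (\<lambda>w. f w / (w - 1) ^ 2) s"
      using ft by (intro is_pole_divide) (simp_all add: isCont_def)
    moreover have "((\<lambda>w. rGamma (w / 2) * mellin (Phi_rem 0) a w) \<longlongrightarrow> rGamma (s / 2) * mellin (Phi_rem 0) a s) (at s)"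
      using Phi_rem_mellin(2)[OF a N] by (intro tendsto_intros rGamma_half_tendsto) (simp add: isCont_def)
    ultimately have pole: "is_pole (\<lambda>w. rGamma (w / 2) * mellin (Phi_rem 0) a w + f w / (w - 1) ^ 2) s"
      unfolding is_pole_def by (intro tendsto_add_filterlim_at_infinity)
    have "eventually (\<lambda>w. S_raw a w = rGamma (w / 2) * mellin (Phi_rem 0) a w + f w / (w - 1) ^ 2) (at s)"
      using eventually_S_raw_eq[OF a N] eventually_neq_at_within[of 1 s]
    proof eventually_elim
      case (elim w)
      have "- 2 / d ^ 2 + c / d = (- 2 + c * d) / d ^ 2" if "d \<noteq> 0" for d
        using that by (simp add: add_divide_distrib diff_divide_distrib power2_eq_square)
      from this[of "w - 1"] have "lead_term a w = (- 2 + c * (w - 1)) / (w - 1) ^ 2"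
        using elim by (simp add: lead_term_def c_def)
      thus ?case using elim by (simp add: S_approx_def S_main_altdef f_def)
    qed
    from is_pole_cong[OF this refl] pole show ?thesis by simp
  next
    case (2 k)
    define m where "m = 2 * k"
    \<comment> \<open>As Re s = 1 - m, the expansion with m terms is valid near s, and its last term
      is the one singular at s. The first m - 1 terms have a finite limit.\<close>
    define m' where "m' = m - 1"
    have m: "m \<ge> 2" "even m" "m = Suc m'" using 2 by (auto simp: m_def m'_def)
    have s_eq: "s = 1 - of_nat m" by (simp add: 2 m_def)
    have N: "Re s > - real m" by (simp add: s_eq)
    define f where "f w = prefactor a w * bern_coeff m a * rGamma (w / 2)" for w
    have ft: "(f \<longlongrightarrow> f s) (at s)"
      unfolding f_def [abs_def] by (intro tendsto_intros prefactor_tendsto rGamma_half_tendsto a)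
    \<comment> \<open>Here s/2 = 1/2 - k is a half-integer, hence not a zero of 1/Gamma.\<close>
    have "rGamma (s / 2) \<noteq> 0"
    proof
      assume "rGamma (s / 2) = 0"
      then obtain j where j: "s / 2 = - of_nat j"
        by (auto simp: rGamma_eq_zero_iff elim!: nonpos_Ints_cases')
      hence "1 + of_nat (2 * j) = (of_nat m :: complex)" by (simp add: s_eq field_simps)
      hence "of_nat (1 + 2 * j) = (of_nat m :: complex)" by simp
      hence "1 + 2 * j = m" by (simp only: of_nat_eq_iff)
      thus False using m(2) by auto
    qed
    moreover have "bern_coeff m a \<noteq> 0"
    proof -
      have "Gamma (real m / 2) > 0" using m(1) by (intro Gamma_real_pos) simp
      thus ?thesis using bernpoly_three_quarters_nonzero[OF m(2)] a by (simp add: bern_coeff_def)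
    qed
    ultimately have "f s \<noteq> 0" by (simp add: f_def pf0)
    moreover have "filterlim (\<lambda>w. w - s) (at 0) (at s)"
      by (auto simp: filterlim_at eventually_at_filter intro!: tendsto_eq_intros)
    ultimately have "is_pole (\<lambda>w. f w / (w - s)) s"
      using ft by (intro is_pole_divide) (simp_all add: isCont_def)
    moreover have "((\<lambda>w. S_main m' a w + rGamma (w / 2) * mellin (Phi_rem m) a w) \<longlongrightarrow>
        ext_main m' a s + rGamma (s / 2) * mellin (Phi_rem m) a s) (at s)"
    proof (intro tendsto_intros rGamma_half_tendsto S_main_tendsto a)
      show "(mellin (Phi_rem m) a \<longlongrightarrow> mellin (Phi_rem m) a s) (at s)"
        using Phi_rem_mellin(2)[OF a N] by (simp add: isCont_def)
      show "s \<noteq> 1" using m(1) by (simp add: s_eq)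
      show "odd n" if "n \<in> {1..m'}" "s + of_nat n - 1 = 0" for n
      proof -
        have "s + of_nat n - 1 = of_nat n - of_nat m" by (simp add: s_eq)
        hence "of_nat n = (of_nat m :: complex)" using that(2) by (metis eq_iff_diff_eq_0)
        hence "n = m" by (rule of_nat_eq_iff[THEN iffD1])
        moreover have "n \<le> m'" using that(1) by simp
        ultimately have False using m(3) by linarith
        thus ?thesis ..
      qed
    qed
    ultimately have pole: "is_pole (\<lambda>w. S_main m' a w + rGamma (w / 2) * mellin (Phi_rem m) a w + f w / (w - s)) s"
      unfolding is_pole_def by (intro tendsto_add_filterlim_at_infinity)
    have "eventually (\<lambda>w. S_raw a w = S_main m' a w + rGamma (w / 2) * mellin (Phi_rem m) a w + f w / (w - s)) (at s)"
      using eventually_S_raw_eq[OF a N]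
    proof eventually_elim
      case (elim w)
      have ws: "w + of_nat m' = w - s" unfolding s_eq m(3) by simp
      have "S_main m a w = S_main m' a w + f w / (w - s)"
        unfolding f_def m(3) S_main_Suc ws by simp
      hence "S_approx m a w = S_main m' a w + rGamma (w / 2) * mellin (Phi_rem m) a w + f w / (w - s)"
        unfolding S_approx_def by (simp only: add_ac)
      thus ?case unfolding elim .
    qed
    from is_pole_cong[OF this refl] pole show ?thesis by simp
  qed
qed

text \<open>The witness is \<open>remove_sings (S_raw a)\<close>. At s = 0, -2, ... the formula for
  \<open>S_raw\<close>, like \<open>S_main\<close>, contains a division by zero; normalising both by
  limits makes their difference meaningful there.\<close>

theorem theorem3p8:
  shows "\<exists>F :: real \<Rightarrow> complex \<Rightarrow> complex.
    (\<forall>a>0. F a nicely_meromorphic_on UNIV \<and>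
           (\<forall>s. Re s > 1 \<longrightarrow> F a s = S_int a s) \<and>
           {s. is_pole (F a) s} = S_poles) \<and>
    (\<forall>(N::nat) (s::complex). Re s > - real N - 1 \<and> s \<notin> S_poles \<longrightarrow>
       (\<lambda>a. F a s - remove_sings (S_main N a) s)
         \<in> O[at_right 0](\<lambda>a. of_real (a powr ((real N + Re s) / 2))))"
proof (intro exI[of _ "\<lambda>a. remove_sings (S_raw a)"] conjI allI impI)
  fix a :: real assume a: "a > 0"
  show "remove_sings (S_raw a) nicely_meromorphic_on UNIV"
    by (rule remove_sings_nicely_meromorphic[OF S_raw_meromorphic[OF a]])
  show "remove_sings (S_raw a) s = S_int a s" if s: "Re s > 1" for s
  proof -
    have "s \<notin> S_poles" using s by (auto simp: S_poles_def)
    hence "remove_sings (S_raw a) s = ext_main 0 a s + rGamma (s / 2) * mellin (Phi_rem 0) a s"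
      using s by (intro remove_sings_eqI S_raw_tendsto a) auto
    also have "\<dots> = S_approx 0 a s"
      by (simp add: S_approx_def ext_main_def S_main_altdef)
    finally show ?thesis using S_approx_0[OF a s] by simp
  qed
  have "isolated_singularity_at (S_raw a) s" for s
    using S_raw_meromorphic[OF a] meromorphic_on_subset by (intro meromorphic_on_isolated_singularity) blast
  hence "is_pole (remove_sings (S_raw a)) s \<longleftrightarrow> is_pole (S_raw a) s" for s
    by (rule is_pole_remove_sings_iff)
  moreover have "is_pole (S_raw a) s \<longleftrightarrow> s \<in> S_poles" for s
  proof
    assume p: "is_pole (S_raw a) s"
    show "s \<in> S_poles"
    proof (rule ccontr)
      assume s: "s \<notin> S_poles"
      have "Re s > - real (nat \<lceil>- Re s\<rceil> + 1)" by linarith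
      from S_raw_tendsto[OF a this s] p show False
        unfolding is_pole_def using not_tendsto_and_filterlim_at_infinity[of "at s"] by simp
    qed
  qed (rule is_pole_S_raw[OF a])
  ultimately show "{s. is_pole (remove_sings (S_raw a)) s} = S_poles" by auto
next
  fix N :: nat and s :: complex
  assume "Re s > - real N - 1 \<and> s \<notin> S_poles"
  \<comment> \<open>\<open>Suc N\<close> is used for every admissible s, so the strip needs no case
    distinction.\<close>
  hence N: "Re s > - real (Suc N)" and s: "s \<notin> S_poles" by auto
  obtain C where C: "C \<ge> 0" "\<And>x. x > 0 \<Longrightarrow> \<bar>Phi_rem (Suc N) x\<bar> \<le> C * x powr (real (Suc N) / 2)"
    using Phi_rem_bound[of "Suc N"] by metis
  define q where "q = real (Suc N) / 2 + Re s / 2"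
  have "q = (Re s + real (Suc N)) / 2" by (simp add: q_def)
  hence q: "q > 0" using N by simp
  define b where "b = \<bar>bernpoly (Suc N) (3/4) / fact (Suc N) * 4 ^ Suc N * Gamma (real (Suc N) / 2) / (4 * sqrt pi)\<bar>"
  \<comment> \<open>The first part bounds the term n = N + 1, of exact order a^((Re s - 1)/2)
    a^((N+1)/2) = a^((N + Re s)/2). The second comes from the Mellin remainder a^q, where q exceeds
    this exponent by 1/2; it is absorbed because a < 1.\<close>
  define K where "K = b * norm (ext_term (Suc N) s) + norm (rGamma (s / 2)) * (C / q)"
  show "(\<lambda>a. remove_sings (S_raw a) s - remove_sings (S_main N a) s)
         \<in> O[at_right 0](\<lambda>a. of_real (a powr ((real N + Re s) / 2)))"
  proof (rule bigoI[of _ K])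
    have "eventually (\<lambda>a. a \<in> {0<..<1}) (at_right (0::real))"
      by (rule eventually_at_right_real) simp
    thus "eventually (\<lambda>a. norm (remove_sings (S_raw a) s - remove_sings (S_main N a) s)
            \<le> K * norm (complex_of_real (a powr ((real N + Re s) / 2)))) (at_right 0)"
    proof eventually_elim
      case (elim a)
      hence a: "a > 0" "a < 1" by auto
      have 1: "remove_sings (S_raw a) s = ext_main (Suc N) a s + rGamma (s / 2) * mellin (Phi_rem (Suc N)) a s"
        by (intro remove_sings_eqI S_raw_tendsto a N s)
      have 2: "remove_sings (S_main N a) s = ext_main N a s"
        using not_in_S_poles[OF s] by (intro remove_sings_eqI S_main_tendsto a) auto
      have "ext_main (Suc N) a s = ext_main N a s + prefactor a s * (bern_coeff (Suc N) a * ext_term (Suc N) s)"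
        by (simp add: ext_main_def algebra_simps)
      hence "norm (remove_sings (S_raw a) s - remove_sings (S_main N a) s) =
          norm (prefactor a s * (bern_coeff (Suc N) a * ext_term (Suc N) s) + rGamma (s / 2) * mellin (Phi_rem (Suc N)) a s)"
        by (simp add: 1 2)
      also have "\<dots> \<le> norm (prefactor a s * bern_coeff (Suc N) a) * norm (ext_term (Suc N) s) + norm (rGamma (s / 2)) * norm (mellin (Phi_rem (Suc N)) a s)"
        by (rule order.trans[OF norm_triangle_ineq]) (simp add: norm_mult)
      finally have le: "norm (remove_sings (S_raw a) s - remove_sings (S_main N a) s) \<le>
          norm (prefactor a s * bern_coeff (Suc N) a) * norm (ext_term (Suc N) s) + norm (rGamma (s / 2)) * norm (mellin (Phi_rem (Suc N)) a s)" .
      have n1: "norm (prefactor a s * bern_coeff (Suc N) a) = b * a powr ((real N + Re s) / 2)"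
      proof -
        have "sqrt a ^ Suc N = a powr (real (Suc N) / 2)"
          using a by (simp add: powr_half_sqrt[symmetric] powr_powr powr_realpow[symmetric] del: power_Suc of_nat_Suc)
        hence e: "a powr ((Re s - 1) / 2) * sqrt a ^ Suc N = a powr ((real N + Re s) / 2)"
          by (simp add: add_divide_distrib[symmetric] add.commute flip: powr_add)
        have "norm (prefactor a s * bern_coeff (Suc N) a) = b * (a powr ((Re s - 1) / 2) * sqrt a ^ Suc N)"
          using a by (simp add: prefactor_def bern_coeff_def b_def norm_mult norm_divide norm_powr_real_powr
              abs_mult power_mult_distrib norm_power mult_ac del: power_Suc of_nat_Suc fact_Suc)
        thus ?thesis by (simp only: e)
      qed
      have n2: "norm (mellin (Phi_rem (Suc N)) a s) \<le> C / q * a powr ((real N + Re s) / 2)"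
      proof -
        have "norm (mellin (Phi_rem (Suc N)) a s) \<le> C * (a powr q / q)"
          unfolding q_def by (rule norm_mellin_le[OF _ a(1) C(1)]) (use C(2) q in \<open>auto simp: q_def\<close>)
        also have "\<dots> = C / q * a powr q" by simp
        also have "\<dots> \<le> C / q * a powr ((real N + Re s) / 2)"
          using a C(1) q by (intro mult_left_mono powr_mono') (auto simp: q_def add_divide_distrib)
        finally show ?thesis .
      qed
      have "norm (remove_sings (S_raw a) s - remove_sings (S_main N a) s) \<le>
          b * a powr ((real N + Re s) / 2) * norm (ext_term (Suc N) s) + norm (rGamma (s / 2)) * (C / q * a powr ((real N + Re s) / 2))"
        using le mult_left_mono[OF n2, of "norm (rGamma (s / 2))"] unfolding n1 by simp
      also have "\<dots> = K * norm (complex_of_real (a powr ((real N + Re s) / 2)))"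
        unfolding K_def by (simp add: algebra_simps)
      finally show ?case .
    qed
  qed
qed


end
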